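(* Suppose that the Gramians $P$ and $Q$ are positive definite and that $\sigma_r\neq\sigma_{r+1}$. Let $y$ be the output of the full system $dx(t)=Ax(t)\,dt+B\,dM(t)$, $y(t)=Cx(t)$, with $x(0)=0$, and let $y_{SPA}$ be the output of the reduced order system obtained by singular perturbation approximation, i.e. of $dx_r(t)=\bar Ax_r(t)\,dt+B_1\,dM(t)$, $y_{SPA}(t)=\bar Cx_r(t)$, with $x_r(0)=0$, where $$\bar A=A_{11}-A_{12}A_{22}^{-1}A_{21},\qquad \bar C=C_1-C_2A_{22}^{-1}A_{21}.$$ Let $P_g\in\mathbb R^{n\times r}$ be the solution of $$AP_g+P_g\bar A^T=-B\mathcal Q_MB_1^T ,$$ and let $P_{g,1}$ denote the first $r$ rows and $P_{g,2}$ the last $n-r$ rows of $TP_g$, where $T$ is the balancing transformation. Then, for every time horizon $\tau>0$, $$\sup_{t\in[0,\tau]}\mathbb E\,\|y(t)-y_{SPA}(t)\|_{\mathbb R^p}\le\Big(\operatorname{tr}\big(\Sigma_2\,(B_2\mathcal Q_MB_2^T-2(A_{22}P_{g,2}+A_{21}P_{g,1})(A_{22}^{-1}A_{21})^T)\big)\Big)^{1/2}.$$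
   Context: Let $A\in\mathbb R^{n\times n}$ be asymptotically stable (all eigenvalues have negative real part), $B\in\mathbb R^{n\times m}$, $C\in\mathbb R^{p\times n}$. $M=(M_1,\dots,M_m)^T$ is an $\mathbb R^m$-valued square integrable Lévy process with mean zero (its components may be correlated), and $\mathcal Q_M=\mathbb E[M(1)M^T(1)]$ is its covariance matrix at time $1$. The stochastic differential equations are understood in the Itô sense. The reachability Gramian $P=\int_0^\infty e^{As}B\mathcal Q_MB^Te^{A^Ts}\,ds$ and the observability Gramian $Q=\int_0^\infty e^{A^Ts}C^TCe^{As}\,ds$ are the unique solutions of $AP+PA^T=-B\mathcal Q_MB^T$ and $A^TQ+QA=-C^TC$. The Hankel singular values are $\sigma_1\ge\dots\ge\sigma_n$, $\sigma_i=\sqrt{\lambda_i(PQ)}$, and $\Sigma=\operatorname{diag}(\sigma_1,\dots,\sigma_n)$. If $P,Q>0$, a balancing transformation is $T=\Sigma^{-1/2}U^TL^T$ with $T^{-1}=KV\Sigma^{-1/2}$, where $P=KK^T$, $Q=LL^T$ are square root factorisations and $K^TL=V\Sigma U^T$ is a singular value decomposition. It satisfies $TPT^T=T^{-T}QT^{-1}=\Sigma$. Fix the reduced dimension $r$ with $1\le r<n$, and partition $$TAT^{-1}=\begin{bmatrix}A_{11}&A_{12}\\ A_{21}&A_{22}\end{bmatrix},\quad TB=\begin{bmatrix}B_1\\ B_2\end{bmatrix},\quad CT^{-1}=\begin{bmatrix}C_1&C_2\end{bmatrix},\quad \Sigma=\begin{bmatrix}\Sigma_1&0\\ 0&\Sigma_2\end{bmatrix},$$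 with $A_{11}\in\mathbb R^{r\times r}$, $B_1\in\mathbb R^{r\times m}$, $C_1\in\mathbb R^{p\times r}$, $\Sigma_1=\operatorname{diag}(\sigma_1,\dots,\sigma_r)$, $\Sigma_2=\operatorname{diag}(\sigma_{r+1},\dots,\sigma_n)$. Under the hypotheses of the claim, $A_{11}$, $A_{22}$ (hence invertible), $A_{11}-A_{12}A_{22}^{-1}A_{21}$ and $A_{22}-A_{21}A_{11}^{-1}A_{12}$ are asymptotically stable (known facts). *)

theory Defs
  imports "HOL-Probability.Probability"
begin

section \<open>Matrices\<close>

text \<open>
  The state space has dimension \<open>n = r + s\<close> and is indexed by the sum type \<open>'r + 's\<close>,
  with \<open>r = CARD('r)\<close> and \<open>s = n - r = CARD('s)\<close>. Indices in \<open>Inl\<close> come before indices in \<open>Inr\<close>;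
  inside each summand the linear order of the index type is used.
\<close>

definition upper_rows :: "'a^'k^('r::finite + 's::finite) \<Rightarrow> 'a^'k^'r" where
  "upper_rows X = (\<chi> i. X $ Inl i)"

definition lower_rows :: "'a^'k^('r::finite + 's::finite) \<Rightarrow> 'a^'k^'s" where
  "lower_rows X = (\<chi> i. X $ Inr i)"

definition left_cols :: "'a^('r::finite + 's::finite)^'k \<Rightarrow> 'a^'r^'k" where
  "left_cols X = (\<chi> i j. X $ i $ Inl j)"

definition right_cols :: "'a^('r::finite + 's::finite)^'k \<Rightarrow> 'a^'s^'k" where
  "right_cols X = (\<chi> i j. X $ i $ Inr j)"

definition diag_mat :: "('k \<Rightarrow> real) \<Rightarrow> real^'k^'k" where
  "diag_mat d = (\<chi> i j. if i = j then d i else 0)"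

definition mat_exp :: "real^'k^'k \<Rightarrow> real^'k^'k" where
  "mat_exp X = (\<Sum>k. (1 / fact k) *\<^sub>R (((**) X ^^ k) (mat 1)))"

definition pos_def :: "real^'k^'k \<Rightarrow> bool" where
  "pos_def X \<longleftrightarrow> transpose X = X \<and> (\<forall>v. v \<noteq> 0 \<longrightarrow> 0 < v \<bullet> (X *v v))"

definition asymptotically_stable :: "real^'k^'k \<Rightarrow> bool" where
  "asymptotically_stable X \<longleftrightarrow>
     (\<forall>(z::complex) v. v \<noteq> 0 \<and> map_matrix complex_of_real X *v v = z *s v \<longrightarrow> Re z < 0)"

text \<open>The family \<open>l\<close> lists all eigenvalues of \<open>X\<close>, repeated according to algebraic multiplicity.\<close>

definition eigenvalue_list :: "real^'k^'k \<Rightarrow> ('k \<Rightarrow> real) \<Rightarrow> bool" where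
  "eigenvalue_list X l \<longleftrightarrow> (\<forall>z. det (mat z - X) = (\<Prod>i\<in>UNIV. z - l i))"

section \<open>Gramians and balancing\<close>

definition reachability_gramian ::
    "real^'n^'n \<Rightarrow> real^'m^'n \<Rightarrow> real^'m^'m \<Rightarrow> real^'n^'n" where
  "reachability_gramian A B QM =
     (LBINT s:{0..}. mat_exp (s *\<^sub>R A) ** B ** QM ** transpose B ** mat_exp (s *\<^sub>R transpose A))"

definition observability_gramian :: "real^'n^'n \<Rightarrow> real^'n^'p \<Rightarrow> real^'n^'n" where
  "observability_gramian A C =
     (LBINT s:{0..}. mat_exp (s *\<^sub>R transpose A) ** transpose C ** C ** mat_exp (s *\<^sub>R A))"

definition decreasing_family :: "('r::linorder + 's::linorder \<Rightarrow> real) \<Rightarrow> bool" where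
  "decreasing_family \<sigma> \<longleftrightarrow>
     antimono (\<lambda>i. \<sigma> (Inl i)) \<and> antimono (\<lambda>j. \<sigma> (Inr j)) \<and> (\<forall>i j. \<sigma> (Inr j) \<le> \<sigma> (Inl i))"

definition hankel_singular_values ::
    "real^('r::{finite,linorder} + 's::{finite,linorder})^('r + 's) \<Rightarrow> real^('r + 's)^('r + 's)
      \<Rightarrow> ('r + 's \<Rightarrow> real) \<Rightarrow> bool" where
  "hankel_singular_values P Q \<sigma> \<longleftrightarrow>
     decreasing_family \<sigma> \<and> (\<exists>l. eigenvalue_list (P ** Q) l \<and> (\<forall>i. \<sigma> i = sqrt (l i)))"

text \<open>
  Square root factorisations of \<open>P\<close> and \<open>Q\<close> together with a singular value decomposition of
  \<open>K\<^sup>T L\<close>; the transformation itself is \<open>\<Sigma>\<^sup>-\<^sup>1\<^sup>/\<^sup>2 U\<^sup>T L\<^sup>T\<close>.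
\<close>

definition balancing_factors ::
    "real^'n^'n \<Rightarrow> real^'n^'n \<Rightarrow> ('n \<Rightarrow> real) \<Rightarrow> real^'n^'n \<Rightarrow> real^'n^'n \<Rightarrow> real^'n^'n \<Rightarrow> real^'n^'n
      \<Rightarrow> bool" where
  "balancing_factors P Q \<sigma> K L U V \<longleftrightarrow>
     P = K ** transpose K \<and> Q = L ** transpose L \<and>
     orthogonal_matrix U \<and> orthogonal_matrix V \<and>
     transpose K ** L = V ** diag_mat \<sigma> ** transpose U"

definition balancing_transformation ::
    "('n \<Rightarrow> real) \<Rightarrow> real^'n^'n \<Rightarrow> real^'n^'n \<Rightarrow> real^'n^'n" where
  "balancing_transformation \<sigma> L U =
     diag_mat (\<lambda>i. 1 / sqrt (\<sigma> i)) ** transpose U ** transpose L"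

section \<open>Levy processes and linear stochastic differential equations\<close>

text \<open>Processes are indexed by \<open>real\<close>; only times \<open>t \<ge> 0\<close> are ever constrained.\<close>

definition cadlag :: "(real \<Rightarrow> 'a::topological_space) \<Rightarrow> bool" where
  "cadlag f \<longleftrightarrow>
     (\<forall>t\<ge>0. (f \<longlongrightarrow> f t) (at_right t)) \<and> (\<forall>t>0. \<exists>l. (f \<longlongrightarrow> l) (at_left t))"

text \<open>
  Stochastic continuity is not listed: it follows from stationary increments and right-continuity.
\<close>

definition levy_process :: "'w measure \<Rightarrow> (real \<Rightarrow> 'w \<Rightarrow> real^'m) \<Rightarrow> bool" where
  "levy_process Pr M \<longleftrightarrow>
     (\<forall>t\<ge>0. M t \<in> borel_measurable Pr) \<and>
     (AE w in Pr. M 0 w = 0) \<and>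
     (\<forall>(t::nat \<Rightarrow> real) k. 0 \<le> t 0 \<and> mono t \<longrightarrow>
        prob_space.indep_vars Pr (\<lambda>_. borel) (\<lambda>i w. M (t (Suc i)) w - M (t i) w) {..<k}) \<and>
     (\<forall>s t. 0 \<le> s \<and> s \<le> t \<longrightarrow>
        distr Pr borel (\<lambda>w. M t w - M s w) = distr Pr borel (M (t - s))) \<and>
     (AE w in Pr. cadlag (\<lambda>t. M t w))"

definition square_integrable_process :: "'w measure \<Rightarrow> (real \<Rightarrow> 'w \<Rightarrow> real^'m) \<Rightarrow> bool" where
  "square_integrable_process Pr M \<longleftrightarrow> (\<forall>t\<ge>0. integrable Pr (\<lambda>w. (norm (M t w))\<^sup>2))"

definition mean_zero_process :: "'w measure \<Rightarrow> (real \<Rightarrow> 'w \<Rightarrow> real^'m) \<Rightarrow> bool" where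
  "mean_zero_process Pr M \<longleftrightarrow> (\<forall>t\<ge>0. (\<integral>w. M t w \<partial>Pr) = 0)"

definition second_moment_matrix :: "'w measure \<Rightarrow> ('w \<Rightarrow> real^'m) \<Rightarrow> real^'m^'m" where
  "second_moment_matrix Pr X = (\<chi> i j. \<integral>w. X w $ i * X w $ j \<partial>Pr)"

text \<open>
  Solution of \<open>dx(t) = A x(t) dt + B dM(t)\<close>, \<open>x(0) = x0\<close>, in integral form. The integrand \<open>B\<close> of
  the Ito integral is constant, hence elementary, so the integral over \<open>(0, t]\<close> is by definition
  \<open>B (M(t) - M(0))\<close>. The drift integral is pathwise and exists because \<open>x\<close> is cadlag.
\<close>

definition linear_sde_solution ::
    "'w measure \<Rightarrow> real^'k^'k \<Rightarrow> real^'m^'k \<Rightarrow> (real \<Rightarrow> 'w \<Rightarrow> real^'m) \<Rightarrow> real^'k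
      \<Rightarrow> (real \<Rightarrow> 'w \<Rightarrow> real^'k) \<Rightarrow> bool" where
  "linear_sde_solution Pr A B M x0 x \<longleftrightarrow>
     (\<forall>t\<ge>0. x t \<in> borel_measurable Pr) \<and>
     (AE w in Pr. cadlag (\<lambda>t. x t w)) \<and>
     (AE w in Pr. \<forall>t\<ge>0.
        x t w = x0 + (LBINT s:{0..t}. A *v x s w) + B *v (M t w - M 0 w))"

end

theory Submission
  imports Defs
begin

text \<open>
  Write \<open>E(s) = C exp(s A) B - Cbar exp(s Abar) B1\<close> for the impulse response of the error system. The output error at
  time \<open>t\<close> is the stochastic convolution \<open>y(t) - y_SPA(t) = \<integral> E(t - s) dM(s)\<close> over \<open>[0, t]\<close>, so the Ito isometry
  gives the second moment \<open>\<integral> tr (E(s) QM E(s)\<^sup>T) ds\<close> over \<open>[0, t]\<close>, and Jensen's inequality turns a bound for it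
  into a bound for the expected norm. The proof has a probabilistic part, which justifies this second
  moment as an upper bound, and an algebraic part, which estimates the integral.

  Algebraic part. Differentiating the function
  \<open>\<Psi>(s) = tr (B\<^sup>T exp(s A)\<^sup>T Q exp(s A) B QM) - 2 tr (C exp(s A) Pg exp(s Abar)\<^sup>T Cbar\<^sup>T) + tr (B1\<^sup>T exp(s Abar)\<^sup>T \<Sigma>1 exp(s Abar) B1 QM)\<close>
  and using the Lyapunov and Sylvester equations of \<open>Q\<close>, \<open>Pg\<close> and \<open>\<Sigma>1\<close> gives \<open>\<Psi>' = - tr (E QM E\<^sup>T) \<le> 0\<close>.
  The outer two terms are nonnegative; the middle one tends to 0, because \<open>exp(s A)\<close> does, while \<open>exp(s Abar)\<close> stays
  bounded: \<open>\<Sigma>1\<close> is a Lyapunov function of the reduced system. Hence \<open>\<Psi> \<ge> 0\<close> and the integral is at most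
  \<open>\<Psi>(0)\<close> (lemma \<open>error_energy_le\<close>). Expanding the observability equation in balanced coordinates into
  blocks shows that \<open>\<Psi>(0)\<close> is the trace in the theorem (lemmas \<open>spa_observability\<close>, \<open>spa_cross_trace\<close> and
  \<open>spa_error_energy_le\<close>).

  Three facts feed this computation. A Gramian defined by an integral that does not converge would be 0, so
  positive definiteness forces convergence, and a convergent Gramian solves its Lyapunov equation and is
  annihilated by the flow in the limit (\<open>gramian_lyapunov\<close>). The balancing transformation makes both
  Gramians equal to \<open>\<Sigma>\<close> (\<open>balancing_transformation\<close>). The gap between the singular values makes \<open>A22\<close>
  invertible (\<open>balanced_block_injective\<close>).

  Probabilistic part. The convolution is approximated by the sums \<open>\<Sum> E(t - t\<^sub>i) (M(t\<^sub>i\<^sub>+\<^sub>1) - M(t\<^sub>i))\<close> on uniform grids.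
  Along each cadlag path they converge to the output error: after summation by parts the integral
  equation of the path turns the difference into an integral that vanishes by dominated convergence
  (\<open>sde_riemann_sum_tendsto\<close>). Their second moments are Riemann sums of \<open>tr (E QM E\<^sup>T)\<close>, since increments
  over disjoint intervals are orthogonal and the second moment of \<open>v \<bullet> M(t)\<close> is linear in \<open>t\<close>
  (\<open>levy_weighted_sum_second_moment\<close>). Fatou's lemma then yields the upper bound
  (\<open>output_error_second_moment\<close>).
\<close>

section \<open>Matrix calculus\<close>

lemma bounded_bilinear_matrix_mult:
  "bounded_bilinear ((**) :: real^'n^'m \<Rightarrow> real^'k^'n \<Rightarrow> real^'k^'m)"
  unfolding bilinear_conv_bounded_bilinear[symmetric] bilinear_def
  by (intro conjI allI linearI)
    (simp_all add: vec_eq_iff matrix_matrix_mult_def sum_distrib_left sum.distrib algebra_simps)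

lemmas matrix_mult_minus_left = bounded_bilinear.minus_left[OF bounded_bilinear_matrix_mult]
lemmas matrix_mult_minus_right = bounded_bilinear.minus_right[OF bounded_bilinear_matrix_mult]
lemmas matrix_mult_diff_left = bounded_bilinear.diff_left[OF bounded_bilinear_matrix_mult]
lemmas matrix_mult_diff_right = bounded_bilinear.diff_right[OF bounded_bilinear_matrix_mult]
lemmas matrix_mult_scaleR_left = bounded_bilinear.scaleR_left[OF bounded_bilinear_matrix_mult]
lemmas matrix_mult_scaleR_right = bounded_bilinear.scaleR_right[OF bounded_bilinear_matrix_mult]
lemmas matrix_mult_zero_left = bounded_bilinear.zero_left[OF bounded_bilinear_matrix_mult]
lemmas matrix_mult_zero_right = bounded_bilinear.zero_right[OF bounded_bilinear_matrix_mult]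
lemmas matrix_mult_distribs = bounded_bilinear.add_left[OF bounded_bilinear_matrix_mult]
  bounded_bilinear.add_right[OF bounded_bilinear_matrix_mult]
  matrix_mult_minus_left matrix_mult_minus_right matrix_mult_diff_left matrix_mult_diff_right
  matrix_mult_scaleR_left matrix_mult_scaleR_right
lemmas has_vector_derivative_matrix_mult =
  bounded_bilinear.has_vector_derivative[OF bounded_bilinear_matrix_mult]
lemmas tendsto_matrix_mult = bounded_bilinear.tendsto[OF bounded_bilinear_matrix_mult]
lemmas continuous_on_matrix_mult = bounded_bilinear.continuous_on[OF bounded_bilinear_matrix_mult]

lemma linear_transpose: "linear (transpose :: real^'n^'m \<Rightarrow> real^'m^'n)"
  by (rule linearI) (auto simp: transpose_def vec_eq_iff)

lemmas bounded_linear_transpose = linear_conv_bounded_linear[THEN iffD1, OF linear_transpose]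
lemmas transpose_distribs = linear_add[OF linear_transpose] linear_diff[OF linear_transpose]
  linear_neg[OF linear_transpose] linear_cmul[OF linear_transpose]

lemma linear_trace: "linear (trace :: real^'n^'n \<Rightarrow> real)"
  by (rule linearI) (auto simp: trace_def sum.distrib sum_distrib_left)

lemmas bounded_linear_trace = linear_conv_bounded_linear[THEN iffD1, OF linear_trace]
lemmas trace_distribs = linear_add[OF linear_trace] linear_diff[OF linear_trace]
  linear_neg[OF linear_trace] linear_cmul[OF linear_trace]

lemma trace_mult_commute:
  fixes X :: "real^'n^'m" and Y :: "real^'m^'n"
  shows "trace (X ** Y) = trace (Y ** X)"
  unfolding trace_def matrix_matrix_mult_def
  by (simp add: mult.commute) (rule sum.swap)

lemma trace_transpose_eq: "trace (transpose X) = trace (X :: real^'n^'n)"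
  by (simp add: trace_def transpose_def)

text \<open>
  The norm of \<open>real^'n^'m\<close> is the Frobenius norm; this identity connects it with traces of Gramian type.
\<close>

lemma trace_mult_transpose_eq_inner:
  fixes X Y :: "real^'n^'m"
  shows "trace (X ** transpose Y) = X \<bullet> Y"
  by (simp add: trace_def transpose_def matrix_matrix_mult_def inner_vec_def)

lemma transpose_diag_mat: "transpose (diag_mat d) = diag_mat d"
  by (auto simp: transpose_def diag_mat_def vec_eq_iff)

lemma diag_mat_mult_vec: "diag_mat d *v v = (\<chi> i. d i * v $ i)"
proof -
  have "(if i = j then d i else 0) * v $ j = (if i = j then d i * v $ i else 0)" for i j
    by simp
  then show ?thesis
    by (simp add: diag_mat_def vec_eq_iff matrix_vector_mult_def)
qed

lemma diag_mat_mult_nth: "(diag_mat d ** X) $ i $ j = d i * X $ i $ j"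
proof -
  have "(if i = k then d i else 0) * X $ k $ j = (if i = k then d i * X $ i $ j else 0)" for k
    by simp
  then show ?thesis
    by (simp add: diag_mat_def matrix_matrix_mult_def)
qed

lemma diag_mat_mult: "diag_mat d ** diag_mat e = diag_mat (\<lambda>i. d i * e i)"
  unfolding vec_eq_iff diag_mat_mult_nth by (simp add: diag_mat_def)

lemma diag_mat_one: "diag_mat (\<lambda>_. 1) = mat 1"
  by (auto simp: diag_mat_def mat_def vec_eq_iff)

section \<open>The matrix exponential\<close>

definition matpow :: "real^'n^'n \<Rightarrow> nat \<Rightarrow> real^'n^'n" where
  "matpow X k = (((**) X) ^^ k) (mat 1)"

lemma matpow_0: "matpow X 0 = mat 1" and matpow_Suc: "matpow X (Suc k) = X ** matpow X k"
  by (simp_all add: matpow_def)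

lemma matpow_scaleR: "matpow (c *\<^sub>R X) k = c ^ k *\<^sub>R matpow X k"
  by (induction k) (simp_all add: matpow_0 matpow_Suc matrix_mult_scaleR_left matrix_mult_scaleR_right)

lemma matpow_commute: "matpow X k ** X = X ** matpow X k"
  by (induction k) (simp_all add: matpow_0 matpow_Suc matrix_mul_assoc[symmetric])

lemma transpose_matpow: "transpose (matpow X k) = matpow (transpose X) k"
  by (induction k) (simp_all add: matpow_0 matpow_Suc matrix_transpose_mul matpow_commute)

lemma norm_matpow_le:
  fixes X :: "real^'n^'n"
  obtains K where "K > 0" "\<And>k. norm (matpow X k) \<le> norm (mat 1 :: real^'n^'n) * K ^ k"
proof -
  obtain K where K: "K > 0" "\<And>(Y :: real^'n^'n) (Z :: real^'n^'n). norm (Y ** Z) \<le> norm Y * norm Z * K"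
    using bounded_bilinear.pos_bounded[OF bounded_bilinear_matrix_mult] by blast
  define K' where "K' = norm X * K + 1"
  have K': "K' > 0" unfolding K'_def using K by (intro add_nonneg_pos mult_nonneg_nonneg) auto
  have "norm (matpow X k) \<le> norm (mat 1 :: real^'n^'n) * K' ^ k" for k
  proof (induction k)
    case (Suc k)
    have "norm (matpow X (Suc k)) \<le> norm X * K * norm (matpow X k)"
      using K(2)[of X "matpow X k"] by (simp add: matpow_Suc mult_ac)
    also have "\<dots> \<le> K' * (norm (mat 1 :: real^'n^'n) * K' ^ k)"
      using Suc K' K by (intro mult_mono) (auto simp: K'_def)
    finally show ?case by (simp add: mult_ac)
  qed (simp add: matpow_0)
  with K' that show thesis by blast
qed

text \<open>
  Powers of a matrix grow at most geometrically, so the scalar exponential series dominates.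
\<close>

lemma summable_norm_matpow:
  fixes X :: "real^'n^'n"
  shows "summable (\<lambda>k. norm (matpow X k) / fact k * r ^ k)"
proof -
  obtain K where K: "K > 0" "\<And>k. norm (matpow X k) \<le> norm (mat 1 :: real^'n^'n) * K ^ k"
    using norm_matpow_le by blast
  have s: "summable (\<lambda>k. norm (mat 1 :: real^'n^'n) * (inverse (fact k) * (K * \<bar>r\<bar>) ^ k))"
    by (intro summable_mult summable_exp)
  have "norm (norm (matpow X k) / fact k * r ^ k)
      \<le> norm (mat 1 :: real^'n^'n) * (inverse (fact k) * (K * \<bar>r\<bar>) ^ k)" for k
  proof -
    have "norm (matpow X k) * \<bar>r\<bar> ^ k \<le> norm (mat 1 :: real^'n^'n) * K ^ k * \<bar>r\<bar> ^ k"
      by (intro mult_right_mono K) auto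
    then show ?thesis
      by (simp add: abs_mult power_abs power_mult_distrib divide_simps mult.assoc)
  qed
  then show ?thesis by (intro summable_comparison_test[OF _ s]) auto
qed

lemma mat_exp_eq: "mat_exp (t *\<^sub>R X) = (\<Sum>k. (t ^ k / fact k) *\<^sub>R matpow X k)"
  unfolding mat_exp_def matpow_def[symmetric] matpow_scaleR by simp

lemma summable_mat_exp: "summable (\<lambda>k. (t ^ k / fact k) *\<^sub>R matpow X k)"
proof (rule summable_norm_cancel)
  show "summable (\<lambda>k. norm ((t ^ k / fact k) *\<^sub>R matpow X k))"
    using summable_norm_matpow[of X "\<bar>t\<bar>"] by (simp add: abs_mult power_abs mult_ac)
qed

lemma mat_exp_zero: "mat_exp (0 *\<^sub>R X) = mat 1"
  unfolding mat_exp_eq by (subst suminf_finite[of "{0}"]) (auto simp: matpow_0)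

lemma transpose_mat_exp: "transpose (mat_exp (t *\<^sub>R X)) = mat_exp (t *\<^sub>R transpose X)"
  unfolding mat_exp_eq bounded_linear.suminf[OF bounded_linear_transpose summable_mat_exp]
  by (simp add: transpose_distribs transpose_matpow)

lemma mat_exp_mult_commute: "mat_exp (t *\<^sub>R X) ** X = X ** mat_exp (t *\<^sub>R X)"
  unfolding mat_exp_eq
    bounded_linear.suminf[OF bounded_bilinear.bounded_linear_left[OF bounded_bilinear_matrix_mult] summable_mat_exp]
    bounded_linear.suminf[OF bounded_bilinear.bounded_linear_right[OF bounded_bilinear_matrix_mult] summable_mat_exp]
  by (simp add: matrix_mult_scaleR_left matrix_mult_scaleR_right matpow_commute)

text \<open>
  Each entry of the exponential is a scalar power series in \<open>t\<close>, which is differentiated term by term.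
\<close>

lemma mat_exp_has_vector_derivative:
  fixes X :: "real^'n^'n"
  shows "((\<lambda>t. mat_exp (t *\<^sub>R X)) has_vector_derivative X ** mat_exp (t *\<^sub>R X)) (at t within S)"
proof -
  have deriv: "((\<lambda>t. mat_exp (t *\<^sub>R X) \<bullet> b) has_real_derivative (X ** mat_exp (t *\<^sub>R X)) \<bullet> b) (at t)"
    if b: "b \<in> Basis" for b :: "real^'n^'n"
  proof -
    define c where "c k = (matpow X k \<bullet> b) / fact k" for k
    have series: "(\<lambda>k. c k * t ^ k) sums (mat_exp (t *\<^sub>R X) \<bullet> b)" for t
      using bounded_linear.sums[OF bounded_linear_inner_left summable_sums[OF summable_mat_exp], of t X b]
      by (simp add: mat_exp_eq c_def mult_ac)
    have "bounded_linear (\<lambda>Y. (X ** Y) \<bullet> b)"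
      using bounded_linear_compose[OF bounded_linear_inner_left
          bounded_bilinear.bounded_linear_right[OF bounded_bilinear_matrix_mult]] .
    from bounded_linear.sums[OF this summable_sums[OF summable_mat_exp], of t X]
    have "(\<lambda>k. diffs c k * t ^ k) sums ((X ** mat_exp (t *\<^sub>R X)) \<bullet> b)"
      by (simp add: mat_exp_eq c_def diffs_def matrix_mult_scaleR_right mult_ac matpow_Suc
        del: of_nat_Suc)
    moreover have "((\<lambda>t. \<Sum>k. c k * t ^ k) has_real_derivative (\<Sum>k. diffs c k * t ^ k)) (at t)"
      using series by (intro termdiffs_strong_converges_everywhere) (auto simp: sums_iff)
    ultimately show ?thesis using series by (simp add: sums_iff)
  qed
  have "((\<lambda>t. mat_exp (t *\<^sub>R X)) has_vector_derivative X ** mat_exp (t *\<^sub>R X)) (at t)"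
    unfolding has_vector_derivative_def
  proof (rule has_derivative_componentwise_within[THEN iffD2], rule ballI)
    fix b :: "real^'n^'n" assume "b \<in> Basis"
    moreover have "(\<lambda>h. (h *\<^sub>R (X ** mat_exp (t *\<^sub>R X))) \<bullet> b) = (*) ((X ** mat_exp (t *\<^sub>R X)) \<bullet> b)"
      by (rule ext) (simp only: inner_scaleR_left mult.commute)
    ultimately show "((\<lambda>t. mat_exp (t *\<^sub>R X) \<bullet> b) has_derivative
        (\<lambda>h. (h *\<^sub>R (X ** mat_exp (t *\<^sub>R X))) \<bullet> b)) (at t)"
      using deriv unfolding has_field_derivative_def by metis
  qed
  then show ?thesis by (rule has_vector_derivative_at_within)
qed

lemma continuous_on_mat_exp: "continuous_on S (\<lambda>t. mat_exp (t *\<^sub>R X))"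
  by (rule continuous_on_vector_derivative) (rule mat_exp_has_vector_derivative)

section \<open>Lyapunov equations of the Gramians\<close>

text \<open>
  All Lyapunov and Sylvester equations enter through this derivative: moving the coefficient matrices inside
  the exponentials puts the left-hand side \<open>A X + X Z\<close> of the equation between the two flows.
\<close>

lemma mat_exp_sandwich_has_vector_derivative:
  fixes A :: "real^'n^'n" and Z :: "real^'k^'k" and X :: "real^'k^'n"
  shows "((\<lambda>t. mat_exp (t *\<^sub>R A) ** X ** mat_exp (t *\<^sub>R Z)) has_vector_derivative
    mat_exp (t *\<^sub>R A) ** (A ** X + X ** Z) ** mat_exp (t *\<^sub>R Z)) (at t within S)"
proof -
  have 1: "((\<lambda>t. mat_exp (t *\<^sub>R A) ** X) has_vector_derivative (A ** mat_exp (t *\<^sub>R A)) ** X) (at t within S)"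
    using bounded_linear.has_vector_derivative[OF bounded_bilinear.bounded_linear_left[OF
        bounded_bilinear_matrix_mult] mat_exp_has_vector_derivative] .
  have "A ** mat_exp (t *\<^sub>R A) = mat_exp (t *\<^sub>R A) ** A"
    by (rule mat_exp_mult_commute[symmetric])
  then show ?thesis
    using has_vector_derivative_matrix_mult[OF 1 mat_exp_has_vector_derivative, of Z]
    by (simp add: matrix_mult_distribs matrix_mul_assoc add.commute)
qed

lemma continuous_on_mat_exp_sandwich:
  fixes A :: "real^'n^'n" and Z :: "real^'k^'k" and X :: "real^'k^'n"
  shows "continuous_on S (\<lambda>t. mat_exp (t *\<^sub>R A) ** X ** mat_exp (t *\<^sub>R Z))"
  by (rule continuous_on_vector_derivative) (rule mat_exp_sandwich_has_vector_derivative)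

lemma has_set_integral_FTC:
  fixes F g :: "real \<Rightarrow> 'a::euclidean_space"
  assumes "a \<le> b" "\<And>s. a \<le> s \<Longrightarrow> s \<le> b \<Longrightarrow> (F has_vector_derivative g s) (at s within {a..b})"
    "continuous_on {a..b} g"
  shows "set_integrable lborel {a..b} g" "(LBINT s:{a..b}. g s) = F b - F a"
  using has_bochner_integral_FTC_Icc[OF assms]
  by (simp_all add: set_integrable_def set_lebesgue_integral_def has_bochner_integral_iff)

text \<open>
  If the limit were nonzero, a positive constant would be integrable near infinity.
\<close>

lemma set_integrable_at_top_limit_zero:
  fixes f :: "real \<Rightarrow> 'a::{banach, second_countable_topology}"
  assumes int: "set_integrable lborel {a..} f" and lim: "(f \<longlongrightarrow> L) at_top"
  shows "L = 0"
proof (rule ccontr)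
  assume "L \<noteq> 0"
  then have "\<forall>\<^sub>F s in at_top. norm L / 2 < norm (f s)"
    using order_tendstoD(1)[OF tendsto_norm[OF lim], of "norm L / 2"] by simp
  then obtain N where N: "\<And>s. s \<ge> N \<Longrightarrow> norm L / 2 < norm (f s)"
    by (auto simp: eventually_at_top_linorder)
  define N' where "N' = max a N"
  have "set_integrable lborel {N'..} f"
    using int by (rule set_integrable_subset) (auto simp: N'_def)
  then have "set_integrable lborel {N'..} (\<lambda>_. norm L / 2)"
    by (rule set_integrable_bound) (use N in \<open>auto simp: N'_def set_borel_measurable_def less_imp_le\<close>)
  then have "integrable lborel (\<lambda>s. 2 / norm L * (indicator {N'..} s *\<^sub>R (norm L / 2)))"
    unfolding set_integrable_def by (rule integrable_mult_right)
  then have "integrable lborel (indicator {N'..} :: real \<Rightarrow> real)"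
    using \<open>L \<noteq> 0\<close> by simp
  then have fin: "emeasure lborel {N'..} < \<infinity>"
    by (simp add: integrable_indicator_iff)
  obtain r where r: "0 \<le> r" "emeasure lborel {N'..} = ennreal r"
    using fin by (metis ennreal_cases less_irrefl infinity_ennreal_def)
  have "ennreal (r + 1) \<le> emeasure lborel {N'..}"
    using emeasure_mono[of "{N'..N' + (r + 1)}" "{N'..}" lborel] r(1) by simp
  with r show False by simp
qed

text \<open>
  The integrand \<open>f\<close> satisfies \<open>f' = A f + f A\<^sup>T\<close>. Integrating this over \<open>[0, t]\<close> shows that \<open>f(t)\<close> converges to
  \<open>A P + P A\<^sup>T + W\<close>, and the limit of an integrable function is 0; this is the Lyapunov equation.
  In turn the equation says that \<open>exp(t A) P exp(t A)\<^sup>T\<close> has derivative \<open>- f\<close>, so it equals the tail of the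
  Gramian integral and tends to 0.
\<close>

lemma gramian_lyapunov:
  fixes A W P :: "real^'n^'n"
  defines "f \<equiv> \<lambda>s. mat_exp (s *\<^sub>R A) ** W ** mat_exp (s *\<^sub>R transpose A)"
  assumes int: "set_integrable lborel {0..} f" and P: "P = (LBINT s:{0..}. f s)"
  shows "A ** P + P ** transpose A = - W"
    and "((\<lambda>t. mat_exp (t *\<^sub>R A) ** P ** mat_exp (t *\<^sub>R transpose A)) \<longlongrightarrow> 0) at_top"
proof -
  define \<Lambda> where "\<Lambda> X = A ** X + X ** transpose A" for X :: "real^'n^'n"
  have bl: "bounded_linear \<Lambda>"
    unfolding \<Lambda>_def
    by (intro bounded_linear_add bounded_bilinear.bounded_linear_left[OF bounded_bilinear_matrix_mult]
        bounded_bilinear.bounded_linear_right[OF bounded_bilinear_matrix_mult])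
  have f': "f s = mat_exp (s *\<^sub>R A) ** W ** mat_exp (s *\<^sub>R transpose A)" for s
    by (simp add: f_def)
  have f0: "f 0 = W" by (simp only: f' mat_exp_zero matrix_mul_lid matrix_mul_rid)
  have cont: "continuous_on S f" for S
    unfolding f_def by (rule continuous_on_mat_exp_sandwich)
  define I where "I t = (LBINT s:{0..t}. f s)" for t
  have I_lim: "(I \<longlongrightarrow> P) at_top"
    unfolding I_def P by (rule tendsto_set_lebesgue_integral_at_top) (use int in auto)
  have int_Icc: "set_integrable lborel {0..t} f" for t
    using int by (rule set_integrable_subset) auto
  have deriv: "(f has_vector_derivative \<Lambda> (f s)) (at s within S)" for s S
  proof -
    have "mat_exp (s *\<^sub>R A) ** (A ** W + W ** transpose A) ** mat_exp (s *\<^sub>R transpose A) = \<Lambda> (f s)"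
      using mat_exp_mult_commute[of s A] mat_exp_mult_commute[of s "transpose A"]
      unfolding \<Lambda>_def f' by (simp add: matrix_mult_distribs matrix_mul_assoc)
        (simp add: matrix_mul_assoc[symmetric])
    then show ?thesis
      using mat_exp_sandwich_has_vector_derivative[of A W "transpose A" s S] by (simp add: f_def)
  qed
  have "\<Lambda> (I t) = f t - W" if "t \<ge> 0" for t
  proof -
    have "(LBINT s:{0..t}. \<Lambda> (f s)) = f t - f 0"
      by (rule has_set_integral_FTC(2)[OF that deriv])
        (intro bounded_linear.continuous_on[OF bl] cont)
    moreover have "(LBINT s:{0..t}. \<Lambda> (f s)) = \<Lambda> (I t)"
      using integral_bounded_linear[OF bl int_Icc[of t, unfolded set_integrable_def]]
      unfolding I_def set_lebesgue_integral_def
      by (simp add: linear_cmul[OF bounded_linear.linear[OF bl]])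
    ultimately show ?thesis by (simp add: f0)
  qed
  then have "\<forall>\<^sub>F t in at_top. \<Lambda> (I t) + W = f t"
    by (intro eventually_at_top_linorderI[of 0]) simp
  moreover have "((\<lambda>t. \<Lambda> (I t) + W) \<longlongrightarrow> \<Lambda> P + W) at_top"
    by (intro tendsto_intros bounded_linear.tendsto[OF bl] I_lim)
  ultimately have "(f \<longlongrightarrow> \<Lambda> P + W) at_top"
    by (rule Lim_transform_eventually[rotated])
  from set_integrable_at_top_limit_zero[OF int this]
  show lyap: "A ** P + P ** transpose A = - W"
    by (simp add: \<Lambda>_def eq_neg_iff_add_eq_0)
  have "I t = P - mat_exp (t *\<^sub>R A) ** P ** mat_exp (t *\<^sub>R transpose A)" if "t \<ge> 0" for t
  proof -
    have eq: "- (mat_exp (s *\<^sub>R A) ** (A ** P + P ** transpose A) ** mat_exp (s *\<^sub>R transpose A)) = f s" for s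
      by (simp add: lyap f' matrix_mult_minus_left matrix_mult_minus_right)
    have "((\<lambda>t. - (mat_exp (t *\<^sub>R A) ** P ** mat_exp (t *\<^sub>R transpose A))) has_vector_derivative f s) (at s within S)" for s S
      using has_vector_derivative_minus[OF mat_exp_sandwich_has_vector_derivative[of A P "transpose A" s S]]
      by (simp only: eq)
    from has_set_integral_FTC(2)[OF that this cont]
    show ?thesis by (simp only: I_def mat_exp_zero matrix_mul_lid matrix_mul_rid) simp
  qed
  then have "\<forall>\<^sub>F t in at_top. P - I t = mat_exp (t *\<^sub>R A) ** P ** mat_exp (t *\<^sub>R transpose A)"
    by (intro eventually_at_top_linorderI[of 0]) simp
  moreover have "((\<lambda>t. P - I t) \<longlongrightarrow> P - P) at_top"
    by (intro tendsto_intros I_lim)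
  ultimately show "((\<lambda>t. mat_exp (t *\<^sub>R A) ** P ** mat_exp (t *\<^sub>R transpose A)) \<longlongrightarrow> 0) at_top"
    by (simp add: Lim_transform_eventually)
qed

lemma norm_sq_eq_trace: "(norm X)\<^sup>2 = trace (X ** transpose X)"
  for X :: "real^'n^'m"
  by (simp add: trace_mult_transpose_eq_inner power2_norm_eq_inner)

lemma norm_transpose: "norm (transpose X) = norm X"
  for X :: "real^'n^'m"
proof -
  have "(norm (transpose X))\<^sup>2 = (norm X)\<^sup>2"
    unfolding norm_sq_eq_trace using trace_mult_commute[of X "transpose X"] by simp
  then show ?thesis by (rule power2_eq_imp_eq) auto
qed

lemma trace_sandwich_eq:
  fixes G :: "real^'m^'k" and QM :: "real^'m^'m"
  shows "trace (G ** QM ** transpose G) = (\<Sum>k\<in>UNIV. G $ k \<bullet> (QM *v (G $ k)))"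
proof -
  have "(G ** QM ** transpose G) $ i $ i = G $ i \<bullet> (QM *v (G $ i))" for i
    by (simp add: matrix_matrix_mult_def transpose_def inner_vec_def matrix_vector_mult_def
      sum_distrib_left sum_distrib_right mult_ac)
      (subst sum.swap, simp add: mult_ac)
  then show ?thesis
    unfolding trace_def by simp
qed

lemma trace_sandwich_nonneg:
  fixes G :: "real^'m^'k" and QM :: "real^'m^'m"
  assumes "\<And>v. 0 \<le> v \<bullet> (QM *v v)"
  shows "0 \<le> trace (G ** QM ** transpose G)"
  unfolding trace_sandwich_eq by (simp add: assms sum_nonneg)

text \<open>
  With \<open>P = K K\<^sup>T\<close> the trace of the decaying matrix is the squared Frobenius norm of \<open>exp(t A) K\<close>.
\<close>

lemma mat_exp_tendsto_zero:
  fixes A P K :: "real^'n^'n"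
  assumes lim: "((\<lambda>t. mat_exp (t *\<^sub>R A) ** P ** mat_exp (t *\<^sub>R transpose A)) \<longlongrightarrow> 0) at_top"
    and P: "P = K ** transpose K" and K: "invertible K"
  shows "((\<lambda>t. mat_exp (t *\<^sub>R A)) \<longlongrightarrow> 0) at_top"
proof -
  obtain K' where K': "K ** K' = mat 1" using K by (auto simp: invertible_def)
  have "((\<lambda>t. trace (mat_exp (t *\<^sub>R A) ** P ** mat_exp (t *\<^sub>R transpose A))) \<longlongrightarrow> 0) at_top"
    using bounded_linear.tendsto[OF bounded_linear_trace lim] by (simp add: trace_def[of 0])
  also have "(\<lambda>t. trace (mat_exp (t *\<^sub>R A) ** P ** mat_exp (t *\<^sub>R transpose A)))
      = (\<lambda>t. (norm (mat_exp (t *\<^sub>R A) ** K))\<^sup>2)"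
    by (simp add: norm_sq_eq_trace P matrix_transpose_mul transpose_mat_exp matrix_mul_assoc)
  finally have "((\<lambda>t. (norm (mat_exp (t *\<^sub>R A) ** K))\<^sup>2) \<longlongrightarrow> 0) at_top" .
  from tendsto_real_sqrt[OF this]
  have "((\<lambda>t. norm (mat_exp (t *\<^sub>R A) ** K)) \<longlongrightarrow> 0) at_top" by simp
  then have "((\<lambda>t. mat_exp (t *\<^sub>R A) ** K) \<longlongrightarrow> 0) at_top"
    by (rule tendsto_norm_zero_cancel)
  from tendsto_matrix_mult[OF this tendsto_const[of K']]
  show ?thesis
    by (simp add: matrix_mul_assoc[symmetric] K' matrix_mult_zero_left)
qed


section \<open>The energy of the error impulse response\<close>

text \<open>
  The function \<open>\<Psi>\<close> in the proof dominates the energy of the error impulse response that is still to come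
  after time \<open>s\<close>: its derivative is minus the integrand, it starts at \<open>\<beta>\<close>, and it is nonnegative. The last point
  needs a bound on \<open>exp(s Ar)\<close>, which the Lyapunov function \<open>S1\<close> provides: \<open>tr (exp(s Ar)\<^sup>T S1 exp(s Ar))\<close>
  decreases.
\<close>

lemma error_energy_le:
  fixes A L Qo :: "real^'n^'n" and B :: "real^'m^'n" and C :: "real^'n^'p"
    and Ar R S1 :: "real^'r^'r" and Br :: "real^'m^'r" and Cr :: "real^'r^'p"
    and QM :: "real^'m^'m" and Pg :: "real^'r^'n"
  defines "E \<equiv> \<lambda>s. C ** mat_exp (s *\<^sub>R A) ** B - Cr ** mat_exp (s *\<^sub>R Ar) ** Br"
    and "\<beta> \<equiv> trace (Qo ** B ** QM ** transpose B) - 2 * trace (C ** Pg ** transpose Cr)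
      + trace (S1 ** Br ** QM ** transpose Br)"
  assumes Qo: "transpose A ** Qo + Qo ** A = - (transpose C ** C)" "Qo = L ** transpose L"
    and S1: "transpose Ar ** S1 + S1 ** Ar = - (transpose Cr ** Cr)" "S1 = R ** transpose R"
      "invertible R"
    and Pg: "A ** Pg + Pg ** transpose Ar = - (B ** QM ** transpose Br)"
    and stable: "((\<lambda>t. mat_exp (t *\<^sub>R A)) \<longlongrightarrow> 0) at_top"
    and QM: "transpose QM = QM" "\<And>v. 0 \<le> v \<bullet> (QM *v v)"
  shows "0 \<le> \<beta>"
    and "0 \<le> t \<Longrightarrow> (LBINT s:{0..t}. trace (E s ** QM ** transpose (E s))) \<le> \<beta>"
    and "continuous_on S (\<lambda>s. trace (E s ** QM ** transpose (E s)))"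
proof -
  define g where "g s = trace (E s ** QM ** transpose (E s))" for s
  define eA where "eA s = mat_exp (s *\<^sub>R A)" for s
  define eR where "eR s = mat_exp (s *\<^sub>R Ar)" for s
  define eA' where "eA' s = mat_exp (s *\<^sub>R transpose A)" for s
  define eR' where "eR' s = mat_exp (s *\<^sub>R transpose Ar)" for s
  have tr[simp]: "transpose (eA s) = eA' s" "transpose (eR s) = eR' s"
    "transpose (eA' s) = eA s" "transpose (eR' s) = eR s" for s
    by (simp_all add: eA_def eR_def eA'_def eR'_def transpose_mat_exp)
  have E: "E s = C ** eA s ** B - Cr ** eR s ** Br" for s
    by (simp add: E_def eA_def eR_def)
  have g_nonneg: "0 \<le> g s" for s
    unfolding g_def by (rule trace_sandwich_nonneg[OF QM(2)])
  have cE: "continuous_on S E" for S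
    unfolding E_def by (intro continuous_intros continuous_on_matrix_mult continuous_on_mat_exp)
  have cont: "continuous_on S g" for S
    unfolding g_def
    by (intro bounded_linear.continuous_on[OF bounded_linear_trace] continuous_on_matrix_mult
        bounded_linear.continuous_on[OF bounded_linear_transpose] cE continuous_on_const)
  then show "continuous_on S (\<lambda>s. trace (E s ** QM ** transpose (E s)))"
    by (simp add: g_def)

  define X1 where "X1 s = eA' s ** Qo ** eA s" for s
  define X2 where "X2 s = eA s ** Pg ** eR' s" for s
  define X3 where "X3 s = eR' s ** S1 ** eR s" for s
  have dX1: "(X1 has_vector_derivative - (eA' s ** (transpose C ** C) ** eA s)) (at s within S)" for s S
    using mat_exp_sandwich_has_vector_derivative[of "transpose A" Qo A s S]
    unfolding X1_def eA'_def eA_def Qo(1) matrix_mult_minus_left matrix_mult_minus_right .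
  have dX2: "(X2 has_vector_derivative - (eA s ** (B ** QM ** transpose Br) ** eR' s)) (at s within S)" for s S
    using mat_exp_sandwich_has_vector_derivative[of A Pg "transpose Ar" s S]
    unfolding X2_def eA_def eR'_def Pg matrix_mult_minus_left matrix_mult_minus_right .
  have dX3: "(X3 has_vector_derivative - (eR' s ** (transpose Cr ** Cr) ** eR s)) (at s within S)" for s S
    using mat_exp_sandwich_has_vector_derivative[of "transpose Ar" S1 Ar s S]
    unfolding X3_def eR'_def eR_def S1(1) matrix_mult_minus_left matrix_mult_minus_right .

  define f1 where "f1 Y = trace (transpose B ** Y ** B ** QM)" for Y
  define f2 where "f2 Y = trace (C ** Y ** transpose Cr)" for Y
  define f3 where "f3 Y = trace (transpose Br ** Y ** Br ** QM)" for Y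
  have bl1: "bounded_linear f1" and bl2: "bounded_linear f2" and bl3: "bounded_linear f3"
    unfolding f1_def f2_def f3_def
    by (intro linear_conv_bounded_linear[THEN iffD1] linearI;
        simp add: matrix_mult_distribs trace_distribs)+
  define \<Psi> where "\<Psi> s = f1 (X1 s) - 2 * f2 (X2 s) + f3 (X3 s)" for s
  have d\<Psi>: "(\<Psi> has_real_derivative - g s) (at s within S)" for s S
  proof -
    have "g s = trace (C ** eA s ** B ** QM ** transpose B ** eA' s ** transpose C)
        - trace (C ** eA s ** B ** QM ** transpose Br ** eR' s ** transpose Cr)
        - trace (Cr ** eR s ** Br ** QM ** transpose B ** eA' s ** transpose C)
        + trace (Cr ** eR s ** Br ** QM ** transpose Br ** eR' s ** transpose Cr)"
      by (simp add: g_def E matrix_mult_distribs trace_distribs transpose_distribs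
          matrix_transpose_mul matrix_mul_assoc)
    also have "trace (Cr ** eR s ** Br ** QM ** transpose B ** eA' s ** transpose C)
        = trace (C ** eA s ** B ** QM ** transpose Br ** eR' s ** transpose Cr)"
      by (subst trace_transpose_eq[symmetric]) (simp add: matrix_transpose_mul QM(1) matrix_mul_assoc)
    also have "trace (C ** eA s ** B ** QM ** transpose B ** eA' s ** transpose C)
        = f1 (eA' s ** (transpose C ** C) ** eA s)"
      unfolding f1_def using trace_mult_commute[of "C ** eA s ** B ** QM" "transpose B ** eA' s ** transpose C"]
      by (simp add: matrix_mul_assoc)
    also have "trace (Cr ** eR s ** Br ** QM ** transpose Br ** eR' s ** transpose Cr)
        = f3 (eR' s ** (transpose Cr ** Cr) ** eR s)"
      unfolding f3_def using trace_mult_commute[of "Cr ** eR s ** Br ** QM" "transpose Br ** eR' s ** transpose Cr"]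
      by (simp add: matrix_mul_assoc)
    also have "trace (C ** eA s ** B ** QM ** transpose Br ** eR' s ** transpose Cr)
        = f2 (eA s ** (B ** QM ** transpose Br) ** eR' s)"
      by (simp add: f2_def matrix_mul_assoc)
    finally have g: "- g s = f1 (- (eA' s ** (transpose C ** C) ** eA s))
        - 2 * f2 (- (eA s ** (B ** QM ** transpose Br) ** eR' s))
        + f3 (- (eR' s ** (transpose Cr ** Cr) ** eR s))"
      by (simp add: linear_neg[OF bounded_linear.linear[OF bl1]] linear_neg[OF bounded_linear.linear[OF bl2]]
          linear_neg[OF bounded_linear.linear[OF bl3]])
    show ?thesis
      unfolding has_real_derivative_iff_has_vector_derivative g \<Psi>_def
      by (intro has_vector_derivative_add has_vector_derivative_diff
          bounded_linear.has_vector_derivative[OF bl1 dX1] bounded_linear.has_vector_derivative[OF bl3 dX3]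
          bounded_linear.has_vector_derivative[OF bounded_linear_mult_right]
          bounded_linear.has_vector_derivative[OF bl2 dX2])
  qed
  have anti: "\<Psi> u \<le> \<Psi> t" if "t \<le> u" for t u
    using that by (rule DERIV_nonpos_imp_nonincreasing) (use d\<Psi>[of _ UNIV] g_nonneg in force)

  \<comment> \<open>The outer terms have the form \<open>tr (N QM N\<^sup>T)\<close> and are nonnegative.\<close>
  have low: "- 2 * f2 (X2 s) \<le> \<Psi> s" for s
  proof -
    have "f1 (X1 s) = trace ((transpose L ** eA s ** B) ** QM ** transpose (transpose L ** eA s ** B))"
      using trace_mult_commute[of "transpose B ** eA' s ** L" "transpose L ** eA s ** B ** QM"]
      by (simp add: f1_def X1_def Qo(2) matrix_transpose_mul matrix_mul_assoc)
    moreover have "f3 (X3 s) = trace ((transpose R ** eR s ** Br) ** QM ** transpose (transpose R ** eR s ** Br))"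
      using trace_mult_commute[of "transpose Br ** eR' s ** R" "transpose R ** eR s ** Br ** QM"]
      by (simp add: f3_def X3_def S1(2) matrix_transpose_mul matrix_mul_assoc)
    ultimately have "0 \<le> f1 (X1 s)" "0 \<le> f3 (X3 s)"
      using trace_sandwich_nonneg[OF QM(2)] by metis+
    then show ?thesis by (simp add: \<Psi>_def)
  qed

  obtain R' where R': "R ** R' = mat 1" "R' ** R = mat 1" using S1(3) by (auto simp: invertible_def)
  have "norm (transpose R ** eR s) \<le> sqrt (trace S1)" if "0 \<le> s" for s
  proof -
    have X3_eq: "trace (X3 s) = (norm (transpose R ** eR s))\<^sup>2" for s
      using trace_mult_commute[of "eR' s ** R" "transpose R ** eR s"]
      by (simp add: X3_def S1(2) norm_sq_eq_trace matrix_transpose_mul matrix_mul_assoc)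
    have "((\<lambda>s. trace (X3 s)) has_real_derivative - (norm (Cr ** eR s))\<^sup>2) (at s)" for s
      using bounded_linear.has_vector_derivative[OF bounded_linear_trace dX3, of s UNIV]
        trace_mult_commute[of "eR' s ** transpose Cr" "Cr ** eR s"]
      by (simp add: has_real_derivative_iff_has_vector_derivative norm_sq_eq_trace matrix_transpose_mul
          matrix_mul_assoc trace_distribs)
    with that have "trace (X3 s) \<le> trace (X3 0)"
      by (intro DERIV_nonpos_imp_nonincreasing[OF that, of "\<lambda>s. trace (X3 s)"]) force
    also have "X3 0 = S1"
      by (simp only: X3_def eR_def eR'_def mat_exp_zero matrix_mul_lid matrix_mul_rid)
    finally show ?thesis by (simp add: X3_eq real_le_rsqrt)
  qed
  then have "\<forall>\<^sub>F s in at_top. norm (eR' s ** R) \<le> sqrt (trace S1)"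
    using norm_transpose[of "transpose R ** eR _"]
    by (intro eventually_at_top_linorderI[of 0]) (simp add: matrix_transpose_mul)
  then have bnd: "Bfun (\<lambda>s. eR' s ** R) at_top"
    by (rule BfunI)
  have "Zfun (\<lambda>s. eA s ** Pg) at_top"
    using stable unfolding eA_def tendsto_Zfun_iff diff_0_right
    by (rule bounded_bilinear.Zfun_left[OF bounded_bilinear_matrix_mult])
  \<comment> \<open>A null function times a bounded one; the invertible factor \<open>R\<close> is inserted to reach the bounded quantity.\<close>
  from bounded_bilinear.Zfun_left[OF bounded_bilinear_matrix_mult
      bounded_bilinear.Zfun_prod_Bfun[OF bounded_bilinear_matrix_mult this bnd], of R']
  have "Zfun X2 at_top"
    by (simp add: X2_def[abs_def] matrix_mul_assoc[symmetric] R')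
  then have "(X2 \<longlongrightarrow> 0) at_top" by (simp add: tendsto_Zfun_iff)
  from tendsto_mult[OF tendsto_const[of "-2"] bounded_linear.tendsto[OF bl2 this]]
  have lim: "((\<lambda>s. - 2 * f2 (X2 s)) \<longlongrightarrow> 0) at_top"
    by (simp add: linear_0[OF bounded_linear.linear[OF bl2]])
  have nonneg: "0 \<le> \<Psi> t" for t
  proof (rule tendsto_upperbound[OF lim])
    show "\<forall>\<^sub>F s in at_top. - 2 * f2 (X2 s) \<le> \<Psi> t"
      by (intro eventually_at_top_linorderI[of t] order_trans[OF low] anti)
  qed simp
  have \<Psi>0: "\<Psi> 0 = \<beta>"
  proof -
    have "X1 0 = Qo" "X2 0 = Pg" "X3 0 = S1"
      unfolding X1_def X2_def X3_def eR_def eR'_def eA_def eA'_def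
      by (simp_all only: mat_exp_zero matrix_mul_lid matrix_mul_rid)
    then show ?thesis
      using trace_mult_commute[of "transpose B" "Qo ** B ** QM"]
        trace_mult_commute[of "transpose Br" "S1 ** Br ** QM"]
      by (simp add: \<Psi>_def \<beta>_def f1_def f2_def f3_def matrix_mul_assoc)
  qed
  show "0 \<le> \<beta>" using nonneg[of 0] by (simp add: \<Psi>0)
  assume t: "0 \<le> t"
  have "((\<lambda>s. - \<Psi> s) has_vector_derivative g s) (at s within S)" for s S
    using has_vector_derivative_minus[OF d\<Psi>[unfolded has_real_derivative_iff_has_vector_derivative], of s S]
    by simp
  from has_set_integral_FTC(2)[OF t this cont]
  have "(LBINT s:{0..t}. g s) = \<beta> - \<Psi> t" by (simp add: \<Psi>0)
  then show "(LBINT s:{0..t}. trace (E s ** QM ** transpose (E s))) \<le> \<beta>"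
    using nonneg[of t] by (simp add: g_def)
qed

section \<open>Block partitions\<close>

lemma sum_UNIV_Plus:
  "(\<Sum>k\<in>(UNIV :: ('r::finite + 's::finite) set). f k) = (\<Sum>i\<in>UNIV. f (Inl i)) + (\<Sum>j\<in>UNIV. f (Inr j))"
  for f :: "_ \<Rightarrow> 'b::comm_monoid_add"
  using sum.Plus[of "UNIV :: 'r set" "UNIV :: 's set" f] by (simp add: UNIV_Plus_UNIV)

lemma upper_rows_mult: "upper_rows (X ** Y) = upper_rows X ** Y"
  and lower_rows_mult: "lower_rows (X ** Y) = lower_rows X ** Y"
  and left_cols_mult: "left_cols (Z ** X') = Z ** left_cols X'"
  and right_cols_mult: "right_cols (Z ** X') = Z ** right_cols X'"
  by (simp_all add: vec_eq_iff matrix_matrix_mult_def upper_rows_def lower_rows_def left_cols_def right_cols_def)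

lemma block_mult:
  fixes X :: "real^('r::finite + 's::finite)^'k"
  shows "X ** Y = left_cols X ** upper_rows Y + right_cols X ** lower_rows Y"
  by (simp add: vec_eq_iff matrix_matrix_mult_def upper_rows_def lower_rows_def left_cols_def
      right_cols_def sum_UNIV_Plus)

lemma transpose_blocks:
  "transpose (left_cols X) = upper_rows (transpose X)"
  "transpose (right_cols X) = lower_rows (transpose X)"
  "transpose (upper_rows Y) = left_cols (transpose Y)"
  "transpose (lower_rows Y) = right_cols (transpose Y)"
  by (simp_all add: vec_eq_iff transpose_def upper_rows_def lower_rows_def left_cols_def right_cols_def)

lemma blocks_distribs:
  fixes X Y :: "real^'k^('r::finite + 's::finite)" and X' Y' :: "real^('r + 's)^'k"
  shows "upper_rows (X + Y) = upper_rows X + upper_rows Y" "upper_rows (- X) = - upper_rows X"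
  "lower_rows (X + Y) = lower_rows X + lower_rows Y" "lower_rows (- X) = - lower_rows X"
  "left_cols (X' + Y') = left_cols X' + left_cols Y'" "left_cols (- X') = - left_cols X'"
  "right_cols (X' + Y') = right_cols X' + right_cols Y'" "right_cols (- X') = - right_cols X'"
  by (simp_all add: vec_eq_iff upper_rows_def lower_rows_def left_cols_def right_cols_def)

lemma diag_mat_blocks:
  fixes \<sigma> :: "('r::finite + 's::finite) \<Rightarrow> real"
  shows "left_cols (upper_rows (diag_mat \<sigma>)) = diag_mat (\<lambda>i. \<sigma> (Inl i))"
    "right_cols (lower_rows (diag_mat \<sigma>)) = diag_mat (\<lambda>j. \<sigma> (Inr j))"
    "right_cols (upper_rows (diag_mat \<sigma>)) = 0"
    "left_cols (lower_rows (diag_mat \<sigma>)) = 0"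
  by (simp_all add: vec_eq_iff upper_rows_def lower_rows_def left_cols_def right_cols_def diag_mat_def)

lemma blocks_commute:
  "upper_rows (left_cols X) = left_cols (upper_rows X)"
  "upper_rows (right_cols X) = right_cols (upper_rows X)"
  "lower_rows (left_cols X) = left_cols (lower_rows X)"
  "lower_rows (right_cols X) = right_cols (lower_rows X)"
  by (simp_all add: vec_eq_iff upper_rows_def lower_rows_def left_cols_def right_cols_def)

lemma block_mult_blocks:
  fixes X :: "real^('r::finite + 's::finite)^('i::finite + 'j::finite)"
    and Y :: "real^('a::finite + 'b::finite)^('r + 's)"
  shows "left_cols (upper_rows (X ** Y)) =
      left_cols (upper_rows X) ** left_cols (upper_rows Y) + right_cols (upper_rows X) ** left_cols (lower_rows Y)"
    "right_cols (upper_rows (X ** Y)) =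
      left_cols (upper_rows X) ** right_cols (upper_rows Y) + right_cols (upper_rows X) ** right_cols (lower_rows Y)"
    "left_cols (lower_rows (X ** Y)) =
      left_cols (lower_rows X) ** left_cols (upper_rows Y) + right_cols (lower_rows X) ** left_cols (lower_rows Y)"
    "right_cols (lower_rows (X ** Y)) =
      left_cols (lower_rows X) ** right_cols (upper_rows Y) + right_cols (lower_rows X) ** right_cols (lower_rows Y)"
  by (simp_all add: upper_rows_mult lower_rows_mult left_cols_mult right_cols_mult
      block_mult[of "upper_rows X"] block_mult[of "lower_rows X"] blocks_distribs)

section \<open>Invertibility of the truncated diagonal block\<close>

lemma matrix_vector_mult_minus_left: "(- X) *v v = - (X *v v)"
  and matrix_vector_mult_minus_right: "X *v (- v) = - (X *v v)" for X :: "real^'n^'m"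
  by (simp_all add: vec_eq_iff matrix_vector_mult_def sum_negf)

text \<open>
  The Cauchy-Schwarz argument for a semidefinite form: moving from \<open>v\<close> a small way against \<open>w = QM v\<close>
  would make the quadratic form negative unless \<open>w = 0\<close>.
\<close>

lemma psd_kernel:
  fixes QM :: "real^'m^'m"
  assumes sym: "transpose QM = QM" and psd: "\<And>v. 0 \<le> v \<bullet> (QM *v v)" and zero: "v \<bullet> (QM *v v) = 0"
  shows "QM *v v = 0"
proof -
  define w where "w = QM *v v"
  have sym': "v \<bullet> (QM *v w) = w \<bullet> w"
    using dot_lmul_matrix[of v QM w] sym by (metis w_def inner_commute transpose_matrix_vector)
  have "0 \<le> (v - e *\<^sub>R w) \<bullet> (QM *v (v - e *\<^sub>R w))" for e by (rule psd)
  then have *: "2 * e * (w \<bullet> w) \<le> e\<^sup>2 * (w \<bullet> (QM *v w))" for e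
    using zero sym'
    by (simp add: matrix_vector_mult_diff_distrib inner_diff_left inner_diff_right w_def[symmetric]
        matrix_vector_mult_scaleR power2_eq_square algebra_simps)
  have "w \<bullet> w \<le> 0"
  proof (rule ccontr)
    assume a: "\<not> w \<bullet> w \<le> 0"
    define c where "c = w \<bullet> (QM *v w)"
    have "c \<ge> 0" by (simp add: c_def psd)
    define W where "W = w \<bullet> w"
    have "W > 0" using a by (simp only: W_def not_le)
    \<comment> \<open>The step \<open>W / (c + 1)\<close> makes the linear term dominate the quadratic one for every \<open>c \<ge> 0\<close>.\<close>
    define d where "d = c + 1"
    have "d > 0" using \<open>c \<ge> 0\<close> by (simp add: d_def)
    have "2 * (W / d) * W * d\<^sup>2 \<le> (W / d)\<^sup>2 * c * d\<^sup>2"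
      using *[of "W / d"] by (intro mult_right_mono) (simp_all add: c_def W_def)
    then have "2 * (c + 1) * W\<^sup>2 \<le> c * W\<^sup>2"
      using \<open>d > 0\<close> by (simp add: d_def[symmetric] power2_eq_square mult_ac)
    moreover have "0 < W\<^sup>2" using \<open>W > 0\<close> by simp
    ultimately have "2 * (c + 1) \<le> c" by (simp only: mult_le_cancel_right_pos)
    then show False using \<open>c \<ge> 0\<close> by simp
  qed
  then have "w = 0" by (metis inner_gt_zero_iff not_le)
  then show ?thesis by (simp add: w_def)
qed

text \<open>
  Let \<open>D\<close> be the second diagonal block of the balanced Gramian. Testing the two \<open>(2,2)\<close> equations with
  \<open>v\<close> and with \<open>D v\<close> shows that the kernel of \<open>A22\<close> is invariant under \<open>D\<^sup>2\<close>, hence contains an eigenvector of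
  \<open>D\<^sup>2\<close> unless it is trivial. On the kernel the two \<open>(1,2)\<close> equations give \<open>A12 D\<^sup>2 = S1\<^sup>2 A12\<close>, so for the
  eigenvector \<open>u\<close> with eigenvalue \<open>s2(j)\<^sup>2\<close> the vector \<open>A12 u\<close> would be an eigenvector of \<open>S1\<^sup>2\<close> with an eigenvalue
  below its spectrum. Thus \<open>A12 u = 0\<close>, and \<open>u\<close> is in the kernel of the full matrix.
\<close>

lemma balanced_block_injective:
  fixes A12 :: "real^'s^'r" and A21 :: "real^'r^'s" and A22 :: "real^'s^'s"
    and B1 :: "real^'m^'r" and B2 :: "real^'m^'s" and C1 :: "real^'r^'p" and C2 :: "real^'s^'p"
  assumes obs12: "transpose A21 ** diag_mat s2 + diag_mat s1 ** A12 = - (transpose C1 ** C2)"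
    and obs22: "transpose A22 ** diag_mat s2 + diag_mat s2 ** A22 = - (transpose C2 ** C2)"
    and reach12: "A12 ** diag_mat s2 + diag_mat s1 ** transpose A21 = - (B1 ** QM ** transpose B2)"
    and reach22: "A22 ** diag_mat s2 + diag_mat s2 ** transpose A22 = - (B2 ** QM ** transpose B2)"
    and QM: "transpose QM = QM" "\<And>v. 0 \<le> v \<bullet> (QM *v v)"
    and gap: "\<And>i j. s2 j < s1 i" and pos: "\<And>j. 0 < s2 j"
    and ker: "\<And>v. A12 *v v = 0 \<Longrightarrow> A22 *v v = 0 \<Longrightarrow> v = 0"
    and v: "A22 *v v = 0"
  shows "v = 0"
proof (rule ccontr)
  define D where "D = diag_mat s2"
  have Dsym: "transpose D = D" by (simp add: D_def transpose_diag_mat)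
  have quad: "u \<bullet> (transpose X *v w) = (X *v u) \<bullet> w" for u w and X :: "real^'a^'b"
    by (metis dot_lmul_matrix transpose_matrix_vector inner_commute)
  have C2v: "C2 *v v = 0" if v: "A22 *v v = 0" for v
  proof -
    have "v \<bullet> ((transpose A22 ** D + D ** A22) *v v) = 0"
      using v quad[of v A22 "D *v v"]
      by (simp add: matrix_vector_mult_add_rdistrib inner_add_right matrix_vector_mul_assoc[symmetric])
    then have "(C2 *v v) \<bullet> (C2 *v v) = 0"
      using obs22 quad[of v C2 "C2 *v v"] unfolding D_def
      by (simp add: matrix_vector_mult_minus_left matrix_vector_mul_assoc[symmetric])
    then show ?thesis by simp
  qed
  have A22'v: "transpose A22 *v (D *v v) = 0" if v: "A22 *v v = 0" for v
    using arg_cong[OF obs22, of "\<lambda>X. X *v v"] C2v[OF v] v unfolding D_def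
    by (simp add: matrix_vector_mult_add_rdistrib matrix_vector_mul_assoc[symmetric] matrix_vector_mult_minus_left)
  have QB2: "QM *v (transpose B2 *v (D *v v)) = 0" if v: "A22 *v v = 0" for v
  proof (rule psd_kernel[OF QM])
    define w where "w = D *v v"
    have w: "transpose A22 *v w = 0" unfolding w_def by (rule A22'v[OF v])
    have "w \<bullet> ((A22 ** D + D ** transpose A22) *v w) = 0"
      using w quad[of w "transpose A22" "D *v w"]
      by (simp add: matrix_vector_mult_add_rdistrib inner_add_right matrix_vector_mul_assoc[symmetric])
    then show "(transpose B2 *v (D *v v)) \<bullet> (QM *v (transpose B2 *v (D *v v))) = 0"
      using reach22 quad[of w "transpose B2" "QM *v (transpose B2 *v w)"] unfolding D_def[symmetric] w_def[symmetric]
      by (simp add: matrix_vector_mult_minus_left matrix_vector_mul_assoc[symmetric])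
  qed
  have inv: "A22 *v (D *v (D *v v)) = 0" if v: "A22 *v v = 0" for v
    using arg_cong[OF reach22, of "\<lambda>X. X *v (D *v v)"] QB2[OF v] A22'v[OF v] unfolding D_def[symmetric]
    by (simp add: matrix_vector_mult_add_rdistrib matrix_vector_mul_assoc[symmetric] matrix_vector_mult_minus_left)
  have A12: "A12 *v (D *v (D *v v)) = diag_mat s1 *v (diag_mat s1 *v (A12 *v v))" if v: "A22 *v v = 0" for v
  proof -
    have "transpose A21 *v (D *v v) = - (diag_mat s1 *v (A12 *v v))"
      using arg_cong[OF obs12, of "\<lambda>X. X *v v"] C2v[OF v] unfolding D_def[symmetric]
      by (simp add: matrix_vector_mult_add_rdistrib matrix_vector_mul_assoc[symmetric]
          matrix_vector_mult_minus_left eq_neg_iff_add_eq_0)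
    moreover have "A12 *v (D *v (D *v v)) = - (diag_mat s1 *v (transpose A21 *v (D *v v)))"
      using arg_cong[OF reach12, of "\<lambda>X. X *v (D *v v)"] QB2[OF v] unfolding D_def[symmetric]
      by (simp add: matrix_vector_mult_add_rdistrib matrix_vector_mul_assoc[symmetric]
          matrix_vector_mult_minus_left eq_neg_iff_add_eq_0)
    ultimately show ?thesis
      by (simp add: matrix_vector_mult_minus_right)
  qed

  \<comment> \<open>A kernel vector of minimal support is an eigenvector of \<open>D\<^sup>2\<close>: subtracting \<open>s2(j)\<^sup>2 u\<close> from \<open>D\<^sup>2 u\<close> removes \<open>j\<close>.\<close>
  define supp where "supp u = {j. u $ j \<noteq> 0}" for u :: "real^'s"
  assume "v \<noteq> 0"
  with v have "\<exists>v. A22 *v v = 0 \<and> v \<noteq> 0" by blast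
  then obtain u where u: "A22 *v u = 0" "u \<noteq> 0"
    and min: "\<And>w. A22 *v w = 0 \<Longrightarrow> w \<noteq> 0 \<Longrightarrow> card (supp u) \<le> card (supp w)"
    using ex_has_least_nat[of "\<lambda>v. A22 *v v = 0 \<and> v \<noteq> 0" v "\<lambda>v. card (supp v)"] v \<open>v \<noteq> 0\<close> by blast
  from u(2) obtain j where j: "u $ j \<noteq> 0" by (auto simp: vec_eq_iff)
  define w where "w = D *v (D *v u) - (s2 j)\<^sup>2 *\<^sub>R u"
  have w_nth: "w $ i = ((s2 i)\<^sup>2 - (s2 j)\<^sup>2) * u $ i" for i
    by (simp add: w_def D_def diag_mat_mult_vec power2_eq_square algebra_simps)
  have "supp w \<subset> supp u"
    using j by (auto simp: supp_def w_nth)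
  then have "card (supp w) < card (supp u)"
    by (intro psubset_card_mono) auto
  moreover have "A22 *v w = 0"
    unfolding w_def by (simp add: matrix_vector_mult_diff_distrib matrix_vector_mult_scaleR inv u)
  ultimately have "w = 0" using min[of w] by fastforce
  then have eig: "D *v (D *v u) = (s2 j)\<^sup>2 *\<^sub>R u" by (simp add: w_def)
  have "(s2 j)\<^sup>2 *\<^sub>R (A12 *v u) = diag_mat s1 *v (diag_mat s1 *v (A12 *v u))"
    using A12[OF u(1)] by (simp add: eig matrix_vector_mult_scaleR)
  then have "(s2 j)\<^sup>2 * (A12 *v u) $ i = (s1 i)\<^sup>2 * (A12 *v u) $ i" for i
    by (simp add: vec_eq_iff diag_mat_mult_vec power2_eq_square mult.assoc)
  moreover have "(s2 j)\<^sup>2 < (s1 i)\<^sup>2" for i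
    using gap[of j i] pos[of j] by (intro power_strict_mono) auto
  ultimately have "A12 *v u = 0"
    by (auto simp: vec_eq_iff) (metis less_irrefl)
  with ker u show False by blast
qed

section \<open>Singular perturbation approximation of a balanced system\<close>

text \<open>
  The observability equation of the full system, compressed to the reduced state by the substitution
  \<open>x2 = - F x1\<close> with \<open>F = A22\<^sup>-\<^sup>1 A21\<close>. Since \<open>A21\<^sup>T = F\<^sup>T A22\<^sup>T\<close>, the terms with \<open>A21\<^sup>T S2\<close> cancel, and \<open>S1\<close>
  remains the observability Gramian of the reduced system.
\<close>

lemma spa_observability:
  fixes A11 :: "real^'r^'r" and A12 :: "real^'s^'r" and A21 F :: "real^'r^'s" and A22 :: "real^'s^'s"
    and C1 :: "real^'r^'p" and C2 :: "real^'s^'p"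
  defines "Ar \<equiv> A11 - A12 ** F" and "Cr \<equiv> C1 - C2 ** F"
  assumes sym: "transpose S1 = S1" "transpose S2 = S2" and F: "A22 ** F = A21"
    and obs11: "transpose A11 ** S1 + S1 ** A11 = - (transpose C1 ** C1)"
    and obs12: "transpose A21 ** S2 + S1 ** A12 = - (transpose C1 ** C2)"
    and obs22: "transpose A22 ** S2 + S2 ** A22 = - (transpose C2 ** C2)"
  shows "transpose Cr ** C1 = transpose F ** S2 ** A21 - transpose Ar ** S1 - S1 ** A11"
    and "transpose Cr ** C2 = transpose F ** S2 ** A22 - S1 ** A12"
    and "transpose Ar ** S1 + S1 ** Ar = - (transpose Cr ** Cr)"
proof -
  have F': "transpose A21 = transpose F ** transpose A22"
    using F by (simp add: matrix_transpose_mul[symmetric])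
  have obs21: "transpose A12 ** S1 + S2 ** A21 = - (transpose C2 ** C1)"
    using arg_cong[OF obs12, of transpose]
    by (simp add: transpose_distribs matrix_transpose_mul sym add.commute)
  have 11: "transpose C1 ** C1 = - (transpose A11 ** S1 + S1 ** A11)" using obs11 by simp
  have 12: "transpose C1 ** C2 = - (transpose A21 ** S2 + S1 ** A12)" using obs12 by simp
  have 21: "transpose C2 ** C1 = - (transpose A12 ** S1 + S2 ** A21)" using obs21 by simp
  have 22: "transpose C2 ** C2 = - (transpose A22 ** S2 + S2 ** A22)" using obs22 by simp
  show C1: "transpose Cr ** C1 = transpose F ** S2 ** A21 - transpose Ar ** S1 - S1 ** A11"
    by (simp add: Cr_def Ar_def transpose_distribs matrix_mult_distribs matrix_transpose_mul
        matrix_mul_assoc[symmetric] 11 21)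
  show C2: "transpose Cr ** C2 = transpose F ** S2 ** A22 - S1 ** A12"
    by (simp add: Cr_def Ar_def transpose_distribs matrix_mult_distribs matrix_transpose_mul
        matrix_mul_assoc[symmetric] 12 22 F')
  have "transpose Cr ** Cr = transpose Cr ** C1 - transpose Cr ** C2 ** F"
    by (simp add: Cr_def matrix_mult_distribs matrix_mul_assoc)
  also have "\<dots> = - (transpose Ar ** S1 + S1 ** Ar)"
    unfolding C1 C2
    by (simp add: Ar_def matrix_mult_distribs matrix_mul_assoc[symmetric] F)
  finally show "transpose Ar ** S1 + S1 ** Ar = - (transpose Cr ** Cr)" by simp
qed

text \<open>
  Inserting the formulas for \<open>Cr\<^sup>T C1\<close> and \<open>Cr\<^sup>T C2\<close> and moving factors cyclically leaves the first block row
  of the equation for the mixed Gramian, paired with \<open>S1\<close>, and a remainder that contains \<open>S2\<close> only.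
\<close>

lemma spa_cross_trace:
  fixes A11 :: "real^'r^'r" and A12 :: "real^'s^'r" and A21 F :: "real^'r^'s" and A22 :: "real^'s^'s"
    and C1 :: "real^'r^'p" and C2 :: "real^'s^'p"
  defines "Ar \<equiv> A11 - A12 ** F" and "Cr \<equiv> C1 - C2 ** F"
  assumes sym: "transpose S1 = S1" "transpose S2 = S2" and F: "A22 ** F = A21"
    and obs11: "transpose A11 ** S1 + S1 ** A11 = - (transpose C1 ** C1)"
    and obs12: "transpose A21 ** S2 + S1 ** A12 = - (transpose C1 ** C2)"
    and obs22: "transpose A22 ** S2 + S2 ** A22 = - (transpose C2 ** C2)"
    and cross: "A11 ** Pg1 + A12 ** Pg2 + Pg1 ** transpose Ar = - W"
  shows "trace ((C1 ** Pg1 + C2 ** Pg2) ** transpose Cr)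
    = trace (S1 ** W) + trace (S2 ** ((A22 ** Pg2 + A21 ** Pg1) ** transpose F))"
proof -
  note obs = spa_observability[OF sym F obs11 obs12 obs22, folded Ar_def Cr_def]
  have W: "W = - (A11 ** Pg1 + A12 ** Pg2 + Pg1 ** transpose Ar)" using cross by simp
  have "trace ((C1 ** Pg1 + C2 ** Pg2) ** transpose Cr)
      = trace (transpose Cr ** C1 ** Pg1 + transpose Cr ** C2 ** Pg2)"
    by (subst trace_mult_commute) (simp add: matrix_mult_distribs matrix_mul_assoc)
  also have "\<dots> = trace (transpose F ** (S2 ** (A22 ** Pg2 + A21 ** Pg1)))
      - trace (transpose Ar ** (S1 ** Pg1)) - trace (S1 ** (A11 ** Pg1 + A12 ** Pg2))"
    unfolding obs by (simp add: matrix_mult_distribs trace_distribs matrix_mul_assoc[symmetric])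
  also have "trace (transpose Ar ** (S1 ** Pg1)) = trace (S1 ** (Pg1 ** transpose Ar))"
    by (subst trace_mult_commute) (simp add: matrix_mul_assoc)
  also have "trace (transpose F ** (S2 ** (A22 ** Pg2 + A21 ** Pg1)))
      = trace (S2 ** ((A22 ** Pg2 + A21 ** Pg1) ** transpose F))"
    by (subst trace_mult_commute) (simp add: matrix_mul_assoc)
  finally show ?thesis
    by (simp add: W matrix_mult_distribs trace_distribs)
qed

section \<open>Balancing\<close>

lemma pos_def_kernel: "pos_def X \<Longrightarrow> X *v v = 0 \<Longrightarrow> v = 0"
  unfolding pos_def_def by (metis inner_zero_right less_irrefl)

lemma invertible_iff_kernel: "invertible X \<longleftrightarrow> (\<forall>v. X *v v = 0 \<longrightarrow> v = 0)" for X :: "real^'n^'n"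
  unfolding invertible_left_inverse matrix_left_invertible_ker ..

lemma matrix_inv_mult:
  fixes X :: "real^'n^'n"
  assumes "invertible X"
  shows "X ** matrix_inv X = mat 1" "matrix_inv X ** X = mat 1"
  using assms someI_ex[of "\<lambda>Y. X ** Y = mat 1 \<and> Y ** X = mat 1"]
  unfolding invertible_def matrix_inv_def by blast+

lemma pos_def_factor_invertible:
  fixes P K :: "real^'n^'n"
  assumes "pos_def P" "P = K ** transpose K"
  shows "invertible K"
proof -
  have "invertible (transpose K)"
    unfolding invertible_iff_kernel
  proof (intro allI impI)
    fix v assume "transpose K *v v = 0"
    then have "P *v v = 0" by (simp only: assms(2) matrix_vector_mul_assoc[symmetric] matrix_vector_mult_0_right)
    then show "v = 0" by (rule pos_def_kernel[OF assms(1)])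
  qed
  then obtain Y where "Y ** transpose K = mat 1" by (auto simp: invertible_left_inverse)
  then have "K ** transpose Y = mat 1" by (metis matrix_transpose_mul transpose_mat transpose_transpose)
  then show ?thesis by (auto simp: invertible_right_inverse)
qed

lemma asymptotically_stable_kernel:
  assumes "asymptotically_stable X" "X *v v = 0"
  shows "v = 0"
proof (rule ccontr)
  assume "v \<noteq> 0"
  define z :: "complex^'a" where "z = (\<chi> i. complex_of_real (v $ i))"
  have "map_matrix complex_of_real X *v z = (\<chi> i. complex_of_real ((X *v v) $ i))"
    by (simp add: vec_eq_iff z_def matrix_vector_mult_def map_matrix_def)
  also have "\<dots> = 0 *s z" by (simp add: assms(2) vec_eq_iff)
  finally have "map_matrix complex_of_real X *v z = 0 *s z" .
  moreover have "z \<noteq> 0" using \<open>v \<noteq> 0\<close> by (simp add: z_def vec_eq_iff)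
  ultimately show False
    using assms(1) unfolding asymptotically_stable_def by force
qed

text \<open>
  If \<open>P Q v = l v\<close> and \<open>w = Q v\<close>, then \<open>w \<bullet> P w = l (v \<bullet> Q v)\<close>, where both quadratic forms are positive.
\<close>

lemma eigenvalue_pos_def_mult:
  assumes P: "pos_def P" and Q: "pos_def Q" and l: "eigenvalue_list (P ** Q) l"
  shows "0 < l i"
proof -
  have "det (mat (l i) - P ** Q) = 0"
    using l unfolding eigenvalue_list_def by (auto intro!: prod_zero)
  then obtain v where v: "(mat (l i) - P ** Q) *v v = 0" "v \<noteq> 0"
    using invertible_det_nz[of "mat (l i) - P ** Q"] unfolding invertible_iff_kernel by blast
  define w where "w = Q *v v"
  have "w \<noteq> 0" using pos_def_kernel[OF Q] v(2) by (auto simp: w_def)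
  have "mat (l i) *v v = l i *\<^sub>R v"
    by (simp add: vec_eq_iff matrix_vector_mult_def mat_def if_distrib if_distribR cong: if_cong)
  then have "P *v w = l i *\<^sub>R v"
    using v(1) by (simp add: w_def matrix_vector_mult_diff_rdistrib matrix_vector_mul_assoc)
  then have "0 < l i * (v \<bullet> w)"
    using P \<open>w \<noteq> 0\<close> unfolding pos_def_def by (metis inner_commute inner_scaleR_right)
  moreover have "0 < v \<bullet> w"
    using Q v(2) unfolding pos_def_def w_def by blast
  ultimately show ?thesis by (simp add: zero_less_mult_iff)
qed

text \<open>
  The singular value decomposition gives \<open>T K = \<Sigma>\<^sup>1\<^sup>/\<^sup>2 V\<^sup>T\<close>, so the orthogonal factor drops out of
  \<open>T K (T K)\<^sup>T\<close>; dually \<open>\<Sigma>\<^sup>1\<^sup>/\<^sup>2 T = U\<^sup>T L\<^sup>T\<close>.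
\<close>

lemma balancing_transformation:
  assumes fac: "balancing_factors P Q \<sigma> K L U V" and pos: "\<And>i. 0 < \<sigma> i"
  defines "T \<equiv> balancing_transformation \<sigma> L U"
  shows "T ** P ** transpose T = diag_mat \<sigma>" "transpose T ** diag_mat \<sigma> ** T = Q"
proof -
  define h where "h = diag_mat (\<lambda>i. 1 / sqrt (\<sigma> i))"
  have h: "h ** diag_mat \<sigma> ** h = mat 1" "h ** diag_mat \<sigma> ** diag_mat \<sigma> ** h = diag_mat \<sigma>"
    using pos less_imp_neq[OF pos, symmetric] unfolding h_def diag_mat_mult diag_mat_one[symmetric]
    by (auto intro!: arg_cong[where f = diag_mat] simp: field_simps real_sqrt_mult[symmetric] less_imp_le)
  have h': "transpose h = h" by (simp add: h_def transpose_diag_mat)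
  have T: "T = h ** transpose U ** transpose L"
    by (simp add: T_def balancing_transformation_def h_def)
  have U: "transpose U ** U = mat 1" "U ** transpose U = mat 1" and V: "transpose V ** V = mat 1"
    and P: "P = K ** transpose K" and Q: "Q = L ** transpose L"
    and KL: "transpose K ** L = V ** diag_mat \<sigma> ** transpose U"
    using fac by (auto simp: balancing_factors_def orthogonal_matrix_def)
  have "T ** K = h ** transpose U ** transpose (transpose K ** L)"
    by (simp add: T matrix_transpose_mul matrix_mul_assoc)
  also have "\<dots> = h ** (transpose U ** U) ** diag_mat \<sigma> ** transpose V"
    by (simp add: KL matrix_transpose_mul matrix_mul_assoc transpose_diag_mat)
  finally have TK: "T ** K = h ** diag_mat \<sigma> ** transpose V" by (simp add: U)
  have "T ** P ** transpose T = (T ** K) ** transpose (T ** K)"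
    by (simp add: P matrix_transpose_mul matrix_mul_assoc)
  also have "\<dots> = h ** diag_mat \<sigma> ** (transpose V ** V) ** diag_mat \<sigma> ** h"
    by (simp only: TK matrix_transpose_mul matrix_mul_assoc transpose_diag_mat h' transpose_transpose)
  finally show "T ** P ** transpose T = diag_mat \<sigma>" by (simp add: V h)
  have "transpose T ** diag_mat \<sigma> ** T = L ** U ** (h ** diag_mat \<sigma> ** h) ** transpose U ** transpose L"
    by (simp add: T matrix_transpose_mul matrix_mul_assoc h')
  also have "\<dots> = L ** (U ** transpose U) ** transpose L" by (simp add: h matrix_mul_assoc)
  finally show "transpose T ** diag_mat \<sigma> ** T = Q" by (simp add: U Q)
qed

lemma trace_blocks:
  fixes X :: "real^('r::finite + 's::finite)^('r + 's)"
  shows "trace X = trace (left_cols (upper_rows X)) + trace (right_cols (lower_rows X))"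
  by (simp add: trace_def sum_UNIV_Plus left_cols_def upper_rows_def right_cols_def lower_rows_def)

text \<open>
  The Bochner integral of a function that is not integrable is 0 by convention, and 0 is not positive
  definite.
\<close>

lemma pos_def_gramian_integrable:
  assumes "pos_def (reachability_gramian A B QM)"
  shows "set_integrable lborel {0..} (\<lambda>s. mat_exp (s *\<^sub>R A) ** (B ** QM ** transpose B) ** mat_exp (s *\<^sub>R transpose A))"
    (is "set_integrable _ _ ?f")
proof (rule ccontr)
  assume "\<not> ?thesis"
  then have "(LBINT s:{0..}. ?f s) = 0"
    unfolding set_integrable_def set_lebesgue_integral_def by (rule not_integrable_integral_eq)
  then have "reachability_gramian A B QM = 0"
    by (simp add: reachability_gramian_def matrix_mul_assoc)
  then have "axis undefined (1::real) = (0 :: real^'a)"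
    using pos_def_kernel[OF assms, of "axis undefined 1"] by simp
  then show False by (simp add: axis_eq_0_iff)
qed

lemma observability_gramian_eq:
  "observability_gramian A C = reachability_gramian (transpose A) (transpose C) (mat 1)"
  unfolding observability_gramian_def reachability_gramian_def by (simp add: matrix_mul_assoc)

lemma pos_def_gramian_lyapunov:
  assumes "pos_def (reachability_gramian A B QM)"
  shows "A ** reachability_gramian A B QM + reachability_gramian A B QM ** transpose A = - (B ** QM ** transpose B)"
    and "((\<lambda>t. mat_exp (t *\<^sub>R A) ** reachability_gramian A B QM ** mat_exp (t *\<^sub>R transpose A)) \<longlongrightarrow> 0) at_top"
  using gramian_lyapunov[OF pos_def_gramian_integrable[OF assms], of "reachability_gramian A B QM"]
  by (simp_all add: reachability_gramian_def matrix_mul_assoc)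

text \<open>
  The Gramian equations are moved to balanced coordinates and split into blocks. The block identities then
  evaluate the constant of the energy estimate: the two traces with \<open>S1\<close> that come from \<open>Q\<close> and from the
  reduced Gramian cancel against twice the one in the mixed trace.
\<close>

lemma spa_error_energy_le:
  fixes A P Q K L U V T At :: "real^('r::{finite,linorder} + 's::{finite,linorder})^('r + 's)"
    and B :: "real^'m^('r + 's)" and C :: "real^('r + 's)^'p" and QM :: "real^'m^'m"
    and Pg :: "real^('r::{finite,linorder})^('r + 's)"
  assumes QM: "transpose QM = QM" "\<And>v. 0 \<le> v \<bullet> (QM *v v)"
    and stable: "asymptotically_stable A"
    and P: "P = reachability_gramian A B QM" "pos_def P"
    and Q: "Q = observability_gramian A C" "pos_def Q"
    and \<sigma>: "hankel_singular_values P Q \<sigma>" "\<sigma> (Inl (Max UNIV)) \<noteq> \<sigma> (Inr (Min UNIV))"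
    and fac: "balancing_factors P Q \<sigma> K L U V"
    and T: "T = balancing_transformation \<sigma> L U"
    and At: "At = T ** A ** matrix_inv T"
    and A11: "A11 = left_cols (upper_rows At)" and A12: "A12 = right_cols (upper_rows At)"
    and A21: "A21 = left_cols (lower_rows At)" and A22: "A22 = right_cols (lower_rows At)"
    and B1: "B1 = upper_rows (T ** B)" and B2: "B2 = lower_rows (T ** B)"
    and C1: "C1 = left_cols (C ** matrix_inv T)" and C2: "C2 = right_cols (C ** matrix_inv T)"
    and S2: "Sigma2 = right_cols (lower_rows (diag_mat \<sigma>))"
    and Ar: "Abar = A11 - A12 ** matrix_inv A22 ** A21"
    and Cr: "Cbar = C1 - C2 ** matrix_inv A22 ** A21"
    and Pg: "A ** Pg + Pg ** transpose Abar = - (B ** QM ** transpose B1)"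
    and Pg1: "Pg1 = upper_rows (T ** Pg)" and Pg2: "Pg2 = lower_rows (T ** Pg)"
  defines "bound \<equiv> trace (Sigma2 ** (B2 ** QM ** transpose B2
             - 2 *\<^sub>R ((A22 ** Pg2 + A21 ** Pg1) ** transpose (matrix_inv A22 ** A21))))"
    and "E \<equiv> \<lambda>s. C ** mat_exp (s *\<^sub>R A) ** B - Cbar ** mat_exp (s *\<^sub>R Abar) ** B1"
  shows "0 \<le> bound"
    and "0 \<le> t \<Longrightarrow> (LBINT s:{0..t}. trace (E s ** QM ** transpose (E s))) \<le> bound"
    and "continuous_on S (\<lambda>s. trace (E s ** QM ** transpose (E s)))"
proof -
  define s1 where "s1 i = \<sigma> (Inl i)" for i
  define s2 where "s2 j = \<sigma> (Inr j)" for j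
  define S1 where "S1 = diag_mat s1"
  have Sigma2: "Sigma2 = diag_mat s2" by (simp add: S2 diag_mat_blocks s2_def[abs_def])
  have pos: "0 < \<sigma> i" for i
    using \<sigma>(1) eigenvalue_pos_def_mult[OF P(2) Q(2)] unfolding hankel_singular_values_def
    by (metis real_sqrt_gt_zero)
  have gap: "s2 j < s1 i" for i j
  proof -
    have dec: "decreasing_family \<sigma>" using \<sigma>(1) by (simp add: hankel_singular_values_def)
    have "\<sigma> (Inr j) \<le> \<sigma> (Inr (Min UNIV))" "\<sigma> (Inl (Max UNIV)) \<le> \<sigma> (Inl i)"
      using dec antimonoD[of "\<lambda>j. \<sigma> (Inr j)" "Min UNIV" j] antimonoD[of "\<lambda>i. \<sigma> (Inl i)" i "Max UNIV"]
      unfolding decreasing_family_def by simp_all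
    moreover have "\<sigma> (Inr (Min UNIV)) \<le> \<sigma> (Inl (Max UNIV))"
      using dec by (simp add: decreasing_family_def)
    ultimately show ?thesis using \<sigma>(2) by (simp add: s1_def s2_def)
  qed
  have PK: "P = K ** transpose K" and QL: "Q = L ** transpose L"
    using fac by (auto simp: balancing_factors_def)
  note TPT = balancing_transformation(1)[OF fac pos, folded T]
  note TST = balancing_transformation(2)[OF fac pos, folded T]
  have "invertible T"
    unfolding invertible_iff_kernel
    using pos_def_kernel[OF Q(2)] by (auto simp: TST[symmetric] matrix_vector_mul_assoc[symmetric])
  note Ti = matrix_inv_mult[OF this]
  define Ti where "Ti = matrix_inv T"
  have Ti1: "T ** Ti = mat 1" "Ti ** T = mat 1" using Ti by (simp_all add: Ti_def)
  have Ti2: "transpose Ti ** transpose T = mat 1"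
    by (simp add: matrix_transpose_mul[symmetric] Ti1)
  note reach = pos_def_gramian_lyapunov[of A B QM, folded P(1), OF P(2)]
  have obs: "transpose A ** Q + Q ** A = - (transpose C ** C)"
    using pos_def_gramian_lyapunov(1)[of "transpose A" "transpose C" "mat 1"] Q
    by (simp add: observability_gramian_eq)
  have eA: "((\<lambda>t. mat_exp (t *\<^sub>R A)) \<longlongrightarrow> 0) at_top"
    by (rule mat_exp_tendsto_zero[OF reach(2) PK pos_def_factor_invertible[OF P(2) PK]])

  have "At ** diag_mat \<sigma> + diag_mat \<sigma> ** transpose At = T ** (A ** (Ti ** T) ** P + P ** (transpose T ** transpose Ti) ** transpose A) ** transpose T"
    unfolding At Ti_def[symmetric] TPT[symmetric]
    by (simp add: matrix_transpose_mul matrix_mult_distribs matrix_mul_assoc)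
  also have "transpose T ** transpose Ti = mat 1"
    by (simp add: matrix_transpose_mul[symmetric] Ti1)
  finally have reach_t: "At ** diag_mat \<sigma> + diag_mat \<sigma> ** transpose At = - ((T ** B) ** QM ** transpose (T ** B))"
    by (simp add: Ti1 reach(1) matrix_transpose_mul matrix_mult_distribs matrix_mul_assoc)
  have "transpose At ** diag_mat \<sigma> + diag_mat \<sigma> ** At
      = transpose Ti ** (transpose A ** Q + Q ** A) ** Ti"
  proof -
    have "transpose Ti ** Q = transpose Ti ** transpose T ** diag_mat \<sigma> ** T"
      "Q ** Ti = transpose T ** diag_mat \<sigma> ** (T ** Ti)"
      by (simp_all add: TST[symmetric] matrix_mul_assoc)
    then have "transpose Ti ** Q = diag_mat \<sigma> ** T" "Q ** Ti = transpose T ** diag_mat \<sigma>"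
      by (simp_all add: Ti1 Ti2)
    then show ?thesis
      unfolding At Ti_def[symmetric]
      by (simp add: matrix_transpose_mul matrix_mult_distribs matrix_mul_assoc)
        (simp add: matrix_mul_assoc[symmetric])
  qed
  then have obs_t: "transpose At ** diag_mat \<sigma> + diag_mat \<sigma> ** At = - (transpose (C ** Ti) ** (C ** Ti))"
    by (simp add: obs matrix_transpose_mul matrix_mult_distribs matrix_mul_assoc)

  have obs11: "transpose A11 ** S1 + S1 ** A11 = - (transpose C1 ** C1)"
    and obs12: "transpose A21 ** Sigma2 + S1 ** A12 = - (transpose C1 ** C2)"
    and obs22: "transpose A22 ** Sigma2 + Sigma2 ** A22 = - (transpose C2 ** C2)"
    using arg_cong[OF obs_t, of "\<lambda>X. left_cols (upper_rows X)"]
      arg_cong[OF obs_t, of "\<lambda>X. right_cols (upper_rows X)"]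
      arg_cong[OF obs_t, of "\<lambda>X. right_cols (lower_rows X)"]
    unfolding A11 A12 A21 A22 S1_def s1_def[abs_def] Sigma2 s2_def[abs_def] C1 C2 Ti_def[symmetric]
    by (simp_all add: transpose_blocks blocks_distribs block_mult_blocks diag_mat_blocks
        matrix_mult_zero_left matrix_mult_zero_right blocks_commute)
      (simp_all add: upper_rows_mult lower_rows_mult left_cols_mult right_cols_mult blocks_commute)
  have reach12: "A12 ** Sigma2 + S1 ** transpose A21 = - (B1 ** QM ** transpose B2)"
    and reach22: "A22 ** Sigma2 + Sigma2 ** transpose A22 = - (B2 ** QM ** transpose B2)"
    using arg_cong[OF reach_t, of "\<lambda>X. right_cols (upper_rows X)"]
      arg_cong[OF reach_t, of "\<lambda>X. right_cols (lower_rows X)"]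
    unfolding A11 A12 A21 A22 S1_def s1_def[abs_def] Sigma2 s2_def[abs_def] B1 B2
    by (simp_all add: transpose_blocks blocks_distribs block_mult_blocks diag_mat_blocks
        matrix_mult_zero_left matrix_mult_zero_right blocks_commute)
      (simp_all add: upper_rows_mult lower_rows_mult left_cols_mult right_cols_mult blocks_commute)

  have ker: "v = 0" if v: "A12 *v v = 0" "A22 *v v = 0" for v
  proof -
    define u :: "real^('r + 's)" where "u = (\<chi> k. case k of Inl _ \<Rightarrow> 0 | Inr j \<Rightarrow> v $ j)"
    have "(At *v u) $ k = 0" for k
      using v unfolding A12 A22
      by (cases k) (simp_all add: vec_eq_iff matrix_vector_mult_def sum_UNIV_Plus u_def
          right_cols_def upper_rows_def lower_rows_def)
    then have "At *v u = 0" by (simp add: vec_eq_iff)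
    then have "T *v (A *v (Ti *v u)) = 0"
      by (simp only: At Ti_def matrix_vector_mul_assoc matrix_mul_assoc)
    then have "Ti *v (T *v (A *v (Ti *v u))) = 0" by simp
    then have "A *v (Ti *v u) = 0" by (simp only: matrix_vector_mul_assoc[of Ti T] Ti1 matrix_vector_mul_lid)
    then have "Ti *v u = 0" by (rule asymptotically_stable_kernel[OF stable])
    then have "T *v (Ti *v u) = 0" by simp
    then have "u = 0" by (simp only: matrix_vector_mul_assoc Ti1 matrix_vector_mul_lid)
    then have "u $ Inr j = 0" for j by simp
    then show "v = 0" by (simp add: u_def vec_eq_iff)
  qed
  have "invertible A22"
    unfolding invertible_iff_kernel
  proof (intro allI impI)
    fix v assume "A22 *v v = 0"
    moreover have "0 < s2 j" for j by (simp add: s2_def pos)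
    ultimately show "v = 0"
      using balanced_block_injective[OF obs12[unfolded Sigma2 S1_def] obs22[unfolded Sigma2]
        reach12[unfolded Sigma2 S1_def] reach22[unfolded Sigma2] QM gap _ ker] by blast
  qed
  note A22i = matrix_inv_mult[OF this]
  define F where "F = matrix_inv A22 ** A21"
  have F: "A22 ** F = A21" by (simp add: F_def matrix_mul_assoc A22i)
  have Ar': "Abar = A11 - A12 ** F" and Cr': "Cbar = C1 - C2 ** F"
    by (simp_all add: Ar Cr F_def matrix_mul_assoc)
  have sym: "transpose S1 = S1" "transpose Sigma2 = Sigma2"
    by (simp_all add: S1_def Sigma2 transpose_diag_mat)

  have S1_lyap: "transpose Abar ** S1 + S1 ** Abar = - (transpose Cbar ** Cbar)"
    unfolding Ar' Cr' by (rule spa_observability(3)[OF sym F obs11 obs12 obs22])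
  define R where "R = diag_mat (\<lambda>i. sqrt (s1 i))"
  have s1_pos: "0 < s1 i" for i by (simp add: s1_def pos)
  have R: "S1 = R ** transpose R" "invertible R"
  proof -
    show "S1 = R ** transpose R"
      using s1_pos by (simp add: S1_def R_def transpose_diag_mat diag_mat_mult less_imp_le)
    have "R ** diag_mat (\<lambda>i. 1 / sqrt (s1 i)) = mat 1"
      using s1_pos by (simp add: R_def diag_mat_mult diag_mat_one[symmetric] less_imp_neq[symmetric])
    then show "invertible R" by (auto simp: invertible_right_inverse)
  qed

  have "upper_rows (T ** (A ** (Ti ** T) ** Pg + Pg ** transpose Abar)) = upper_rows (- (T ** B ** QM ** transpose B1))"
    by (simp add: Ti1 Pg matrix_mult_distribs matrix_mul_assoc)
  moreover have "upper_rows (T ** (A ** (Ti ** T) ** Pg + Pg ** transpose Abar))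
      = upper_rows At ** (T ** Pg) + Pg1 ** transpose Abar"
    by (simp add: Pg1 At Ti_def[symmetric] matrix_mult_distribs matrix_mul_assoc blocks_distribs upper_rows_mult)
  ultimately have cross: "A11 ** Pg1 + A12 ** Pg2 + Pg1 ** transpose Abar = - (B1 ** QM ** transpose B1)"
    by (simp add: block_mult[of "upper_rows At"] A11 A12 Pg1 Pg2 B1 blocks_distribs upper_rows_mult)
  have CPg: "C ** Pg = C1 ** Pg1 + C2 ** Pg2"
  proof -
    have "C ** Pg = C ** (Ti ** T) ** Pg" by (simp add: Ti1)
    also have "\<dots> = (C ** Ti) ** (T ** Pg)" by (simp add: matrix_mul_assoc)
    also have "\<dots> = C1 ** Pg1 + C2 ** Pg2"
      unfolding C1 C2 Pg1 Pg2 Ti_def by (rule block_mult)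
    finally show ?thesis .
  qed
  have trQ: "trace (Q ** B ** QM ** transpose B)
      = trace (S1 ** (B1 ** QM ** transpose B1)) + trace (Sigma2 ** (B2 ** QM ** transpose B2))"
  proof -
    define TB where "TB = T ** B"
    have "trace (Q ** B ** QM ** transpose B) = trace (diag_mat \<sigma> ** (TB ** QM ** transpose TB))"
      using trace_mult_commute[of "transpose T" "diag_mat \<sigma> ** T ** B ** QM ** transpose B"]
      by (simp add: TB_def TST[symmetric] matrix_transpose_mul matrix_mul_assoc)
    also have "\<dots> = trace (S1 ** (B1 ** QM ** transpose B1)) + trace (Sigma2 ** (B2 ** QM ** transpose B2))"
      unfolding trace_blocks block_mult_blocks diag_mat_blocks S1_def Sigma2 s1_def[abs_def] s2_def[abs_def] B1 B2 TB_def[symmetric]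
      by (simp add: matrix_mult_zero_left transpose_blocks upper_rows_mult lower_rows_mult left_cols_mult right_cols_mult)
    finally show ?thesis .
  qed
  have bound: "bound = trace (Q ** B ** QM ** transpose B) - 2 * trace (C ** Pg ** transpose Cbar)
      + trace (S1 ** B1 ** QM ** transpose B1)"
    unfolding CPg trQ bound_def F_def[symmetric]
    using spa_cross_trace[OF sym F obs11 obs12 obs22 cross[unfolded Ar'], folded Cr']
    by (simp add: matrix_mult_distribs trace_distribs matrix_mul_assoc)
  have E: "E s = C ** mat_exp (s *\<^sub>R A) ** B - Cbar ** mat_exp (s *\<^sub>R Abar) ** B1" for s
    by (simp add: E_def)
  note energy = error_energy_le[OF obs QL S1_lyap R Pg eA QM, folded bound E]
  show "0 \<le> bound" by (rule energy(1))
  show "(LBINT s:{0..t}. trace (E s ** QM ** transpose (E s))) \<le> bound" if "0 \<le> t"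
    by (rule energy(2)[OF that])
  show "continuous_on S (\<lambda>s. trace (E s ** QM ** transpose (E s)))" by (rule energy(3))
qed

section \<open>Second moments of a square integrable Levy process\<close>

text \<open>
  An additive nonnegative function is increasing; comparing \<open>n t\<close> with the integers next to it bounds
  \<open>n\<close> times the deviation from linearity by the value at 1.
\<close>

lemma additive_nonneg_imp_linear:
  fixes f :: "real \<Rightarrow> real"
  assumes add: "\<And>s t. 0 \<le> s \<Longrightarrow> 0 \<le> t \<Longrightarrow> f (s + t) = f s + f t"
    and nonneg: "\<And>t. 0 \<le> t \<Longrightarrow> 0 \<le> f t" and t: "0 \<le> t"
  shows "f t = t * f 1"
proof -
  have f0: "f 0 = 0" using add[of 0 0] by simp
  have mult: "f (real n * t) = real n * f t" if "0 \<le> t" for n t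
  proof (induction n)
    case (Suc n)
    have "f (real (Suc n) * t) = f (real n * t + t)" by (simp add: algebra_simps)
    also have "\<dots> = f (real n * t) + f t" using that by (intro add) auto
    finally show ?case using Suc by (simp add: algebra_simps)
  qed (simp add: f0)
  have mono: "f s \<le> f u" if "0 \<le> s" "s \<le> u" for s u
    using add[of s "u - s"] nonneg[of "u - s"] that by simp
  have bound: "real n * \<bar>f t - t * f 1\<bar> \<le> f 1" for n
  proof -
    define m where "m = nat \<lfloor>real n * t\<rfloor>"
    have m: "real m \<le> real n * t" "real n * t \<le> real (Suc m)"
      using t by (auto simp: m_def) linarith
    have "real m * f 1 \<le> real n * f t" "real n * f t \<le> real (Suc m) * f 1"
      using mono[of "real m * 1" "real n * t"] mono[of "real n * t" "real (Suc m) * 1"] m t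
      unfolding mult[OF t] mult[OF zero_le_one] by auto
    moreover have "real m * f 1 \<le> real n * t * f 1" "real n * t * f 1 \<le> real (Suc m) * f 1"
      using m nonneg[of 1] by (auto intro: mult_right_mono)
    ultimately have "\<bar>real n * f t - real n * t * f 1\<bar> \<le> f 1"
      by (simp add: algebra_simps abs_le_iff)
    also have "real n * f t - real n * t * f 1 = real n * (f t - t * f 1)"
      by (simp add: algebra_simps)
    finally show ?thesis by (simp add: abs_mult)
  qed
  show ?thesis
  proof (rule ccontr)
    assume "f t \<noteq> t * f 1"
    then obtain n where "f 1 < real n * \<bar>f t - t * f 1\<bar>"
      using reals_Archimedean3[of "\<bar>f t - t * f 1\<bar>"] by auto
    with bound[of n] show False by simp
  qed
qed

text \<open>
  Independent centred variables are orthogonal, so the mixed terms vanish.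
\<close>

lemma (in prob_space) expectation_square_sum_indep:
  fixes X :: "'i \<Rightarrow> 'a \<Rightarrow> real"
  assumes "finite I" "indep_vars (\<lambda>_. borel) X I"
    and "\<And>i. i \<in> I \<Longrightarrow> integrable M (\<lambda>w. (X i w)\<^sup>2)" "\<And>i. i \<in> I \<Longrightarrow> expectation (X i) = 0"
  shows "integrable M (\<lambda>w. (\<Sum>i\<in>I. X i w)\<^sup>2)"
    and "expectation (\<lambda>w. (\<Sum>i\<in>I. X i w)\<^sup>2) = (\<Sum>i\<in>I. expectation (\<lambda>w. (X i w)\<^sup>2))"
proof -
  have "integrable M (\<lambda>w. (\<Sum>i\<in>I. X i w)\<^sup>2) \<and>
    expectation (\<lambda>w. (\<Sum>i\<in>I. X i w)\<^sup>2) = (\<Sum>i\<in>I. expectation (\<lambda>w. (X i w)\<^sup>2))"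
    using assms
  proof (induction I rule: finite_induct)
    case (insert i I)
    have meas[measurable]: "X j \<in> borel_measurable M" if "j \<in> insert i I" for j
      using insert.prems(1) that by (auto simp: indep_vars_def2)
    have [measurable]: "X i \<in> borel_measurable M" by (rule meas) simp
    define S where "S w = (\<Sum>j\<in>I. X j w)" for w
    have S[measurable]: "S \<in> borel_measurable M"
      unfolding S_def by (intro borel_measurable_sum meas) auto
    have IH: "integrable M (\<lambda>w. (S w)\<^sup>2)" "expectation (\<lambda>w. (S w)\<^sup>2) = (\<Sum>i\<in>I. expectation (\<lambda>w. (X i w)\<^sup>2))"
      using insert indep_vars_subset[OF insert.prems(1), of I] unfolding S_def by auto
    have ind: "indep_var borel (X i) borel S"
      unfolding S_def by (rule indep_vars_sum[OF insert.hyps insert.prems(1)])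
    have Xi: "integrable M (\<lambda>w. (X i w)\<^sup>2)" "expectation (X i) = 0" using insert.prems by auto
    have int: "integrable M (X i)" "integrable M S"
      by (rule square_integrable_imp_integrable[OF _ Xi(1)], simp)
        (rule square_integrable_imp_integrable[OF _ IH(1)], simp)
    have XS: "integrable M (\<lambda>w. X i w * S w)" "expectation (\<lambda>w. X i w * S w) = 0"
      using indep_var_integrable[OF ind int] indep_var_lebesgue_integral[OF ind int] Xi by auto
    have eq: "(\<Sum>j\<in>insert i I. X j w)\<^sup>2 = (X i w)\<^sup>2 + (S w)\<^sup>2 + 2 * (X i w * S w)" for w
      using insert.hyps by (simp add: S_def power2_sum algebra_simps)
    show ?case
      unfolding eq using Xi IH XS insert.hyps by (simp add: integrable_add)
  qed auto
  then show "integrable M (\<lambda>w. (\<Sum>i\<in>I. X i w)\<^sup>2)"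
    and "expectation (\<lambda>w. (\<Sum>i\<in>I. X i w)\<^sup>2) = (\<Sum>i\<in>I. expectation (\<lambda>w. (X i w)\<^sup>2))" by auto
qed

lemma (in prob_space) second_moment_matrix:
  fixes X :: "'a \<Rightarrow> real^'m"
  assumes X: "X \<in> borel_measurable M" and int: "integrable M (\<lambda>w. (norm (X w))\<^sup>2)"
  shows "transpose (second_moment_matrix M X) = second_moment_matrix M X"
    and "integrable M (\<lambda>w. (v \<bullet> X w)\<^sup>2)"
    and "expectation (\<lambda>w. (v \<bullet> X w)\<^sup>2) = v \<bullet> (second_moment_matrix M X *v v)"
proof -
  note [measurable] = X
  show "transpose (second_moment_matrix M X) = second_moment_matrix M X"
    by (simp add: second_moment_matrix_def transpose_def mult.commute)
  have prod: "integrable M (\<lambda>w. X w $ i * X w $ j)" for i j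
  proof (rule Bochner_Integration.integrable_bound[OF int])
    have "\<bar>X w $ i * X w $ j\<bar> \<le> norm (X w) * norm (X w)" for w
      unfolding abs_mult by (intro mult_mono component_le_norm_cart) auto
    then show "AE w in M. norm (X w $ i * X w $ j) \<le> norm ((norm (X w))\<^sup>2)"
      by (simp add: power2_eq_square)
    have "(\<lambda>w. X w \<bullet> axis i 1) \<in> borel_measurable M" for i by measurable
    then have "(\<lambda>w. X w $ i) \<in> borel_measurable M" for i by (simp add: inner_axis)
    then show "(\<lambda>w. X w $ i * X w $ j) \<in> borel_measurable M" by measurable
  qed
  have eq: "(v \<bullet> X w)\<^sup>2 = (\<Sum>i\<in>UNIV. \<Sum>j\<in>UNIV. v $ i * v $ j * (X w $ i * X w $ j))" for w
    by (simp add: inner_vec_def power2_eq_square sum_product mult_ac)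
  show "integrable M (\<lambda>w. (v \<bullet> X w)\<^sup>2)"
    unfolding eq using prod by auto
  show "expectation (\<lambda>w. (v \<bullet> X w)\<^sup>2) = v \<bullet> (second_moment_matrix M X *v v)"
    unfolding eq using prod
    by (simp add: inner_vec_def matrix_vector_mult_def second_moment_matrix_def sum_distrib_left mult_ac)
qed

text \<open>
  A discrete Ito isometry. By stationarity the second moment of \<open>v \<bullet> (M(r) - M(s))\<close> is a function of \<open>r - s\<close>;
  orthogonality on a grid with two cells makes it additive, hence linear, and \<open>QM\<close> is its value at time 1.
\<close>

lemma levy_weighted_sum_second_moment:
  fixes M :: "real \<Rightarrow> 'w \<Rightarrow> real^'m"
  assumes Pr: "prob_space Pr" and levy: "levy_process Pr M"
    and sq: "square_integrable_process Pr M" and zero: "mean_zero_process Pr M"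
  defines "QM \<equiv> second_moment_matrix Pr (M 1)"
  assumes t: "0 \<le> t 0" "mono t"
  shows "integrable Pr (\<lambda>w. (\<Sum>i<n. u i \<bullet> (M (t (Suc i)) w - M (t i) w))\<^sup>2)"
    and "(\<integral>w. (\<Sum>i<n. u i \<bullet> (M (t (Suc i)) w - M (t i) w))\<^sup>2 \<partial>Pr)
      = (\<Sum>i<n. (t (Suc i) - t i) * (u i \<bullet> (QM *v u i)))"
proof -
  interpret prob_space Pr by fact
  have meas: "M s \<in> borel_measurable Pr" if "0 \<le> s" for s
    using levy that by (simp add: levy_process_def)
  have sq': "integrable Pr (\<lambda>w. (v \<bullet> M s w)\<^sup>2)" if "0 \<le> s" for v s
    using second_moment_matrix(2)[OF meas[OF that]] sq that by (auto simp: square_integrable_process_def)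
  define \<phi> where "\<phi> v s = expectation (\<lambda>w. (v \<bullet> M s w)\<^sup>2)" for v s
  have incr_sq: "integrable Pr (\<lambda>w. (v \<bullet> (M r w - M s w))\<^sup>2)"
    and incr_\<phi>: "expectation (\<lambda>w. (v \<bullet> (M r w - M s w))\<^sup>2) = \<phi> v (r - s)"
    and incr_zero: "expectation (\<lambda>w. v \<bullet> (M r w - M s w)) = 0" if "0 \<le> s" "s \<le> r" for v r s
  proof -
    have [measurable]: "M r \<in> borel_measurable Pr" "M s \<in> borel_measurable Pr" "M (r - s) \<in> borel_measurable Pr"
      using meas that by auto
    have distr: "distr Pr borel (\<lambda>w. M r w - M s w) = distr Pr borel (M (r - s))"
      using levy that by (simp add: levy_process_def)
    have "integrable (distr Pr borel (M (r - s))) (\<lambda>z. (v \<bullet> z)\<^sup>2)"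
      using sq'[of "r - s" v] that by (subst integrable_distr_eq) auto
    then show "integrable Pr (\<lambda>w. (v \<bullet> (M r w - M s w))\<^sup>2)"
      unfolding distr[symmetric] by (subst (asm) integrable_distr_eq) auto
    have "expectation (\<lambda>w. (v \<bullet> (M r w - M s w))\<^sup>2) = (\<integral>z. (v \<bullet> z)\<^sup>2 \<partial>distr Pr borel (\<lambda>w. M r w - M s w))"
      by (subst integral_distr) auto
    also have "\<dots> = \<phi> v (r - s)"
      unfolding distr \<phi>_def by (subst integral_distr) auto
    finally show "expectation (\<lambda>w. (v \<bullet> (M r w - M s w))\<^sup>2) = \<phi> v (r - s)" .
    have int: "integrable Pr (M s)" if "0 \<le> s" for s
    proof -
      have "integrable Pr (\<lambda>w. norm (M s w))"
        using sq that meas[OF that] square_integrable_imp_integrable[of "\<lambda>w. norm (M s w)"]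
        by (auto simp: square_integrable_process_def)
      then show ?thesis using meas[OF that] by (simp add: integrable_norm_iff)
    qed
    show "expectation (\<lambda>w. v \<bullet> (M r w - M s w)) = 0"
      using int[of r] int[of s] zero that by (simp add: mean_zero_process_def)
  qed
  have sums: "integrable Pr (\<lambda>w. (\<Sum>i<n. u i \<bullet> (M (t (Suc i)) w - M (t i) w))\<^sup>2)"
      "expectation (\<lambda>w. (\<Sum>i<n. u i \<bullet> (M (t (Suc i)) w - M (t i) w))\<^sup>2) = (\<Sum>i<n. \<phi> (u i) (t (Suc i) - t i))"
    if t: "0 \<le> t 0" "mono t" for t :: "nat \<Rightarrow> real" and u n
  proof -
    have t': "0 \<le> t i" "t i \<le> t (Suc i)" for i
      using t monoD[OF t(2), of 0 i] monoD[OF t(2), of i "Suc i"] by auto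
    have "indep_vars (\<lambda>_. borel) (\<lambda>i w. M (t (Suc i)) w - M (t i) w) {..<n}"
      using levy t by (auto simp: levy_process_def)
    then have "indep_vars (\<lambda>_. borel) (\<lambda>i w. u i \<bullet> (M (t (Suc i)) w - M (t i) w)) {..<n}"
      by (rule indep_vars_compose2) simp
    from expectation_square_sum_indep[OF _ this] incr_sq[OF t'] incr_zero[OF t'] incr_\<phi>[OF t']
    show "integrable Pr (\<lambda>w. (\<Sum>i<n. u i \<bullet> (M (t (Suc i)) w - M (t i) w))\<^sup>2)"
      "expectation (\<lambda>w. (\<Sum>i<n. u i \<bullet> (M (t (Suc i)) w - M (t i) w))\<^sup>2) = (\<Sum>i<n. \<phi> (u i) (t (Suc i) - t i))"
      by auto
  qed
  have \<phi>_add: "\<phi> v (s + r) = \<phi> v s + \<phi> v r" if "0 \<le> s" "0 \<le> r" for v s r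
  proof -
    define t where "t i = (if i = 0 then 0 else if i = 1 then s else s + r)" for i :: nat
    have "mono t" unfolding mono_iff_le_Suc using that by (auto simp: t_def)
    have "expectation (\<lambda>w. (\<Sum>i<2. v \<bullet> (M (t (Suc i)) w - M (t i) w))\<^sup>2)
        = (\<Sum>i<2. \<phi> v (t (Suc i) - t i))"
      by (rule sums(2)[OF _ \<open>mono t\<close>]) (simp add: t_def)
    moreover have "(\<Sum>i<2. v \<bullet> (M (t (Suc i)) w - M (t i) w)) = v \<bullet> (M (s + r) w - M 0 w)" for w
      by (simp add: numeral_2_eq_2 t_def inner_diff_right)
    ultimately show ?thesis
      using incr_\<phi>[of 0 "s + r" v] that by (simp add: numeral_2_eq_2 t_def)
  qed
  have "\<phi> v s = s * \<phi> v 1" if "0 \<le> s" for v s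
    using additive_nonneg_imp_linear[of "\<phi> v", OF \<phi>_add _ that] by (simp add: \<phi>_def)
  moreover have "\<phi> v 1 = v \<bullet> (QM *v v)" for v
    unfolding \<phi>_def QM_def
    using second_moment_matrix(3)[OF meas[of 1]] sq by (simp add: square_integrable_process_def)
  ultimately have \<phi>: "\<phi> v s = s * (v \<bullet> (QM *v v))" if "0 \<le> s" for v s
    using that by simp
  show "integrable Pr (\<lambda>w. (\<Sum>i<n. u i \<bullet> (M (t (Suc i)) w - M (t i) w))\<^sup>2)"
    by (rule sums(1)[OF t])
  show "(\<integral>w. (\<Sum>i<n. u i \<bullet> (M (t (Suc i)) w - M (t i) w))\<^sup>2 \<partial>Pr)
      = (\<Sum>i<n. (t (Suc i) - t i) * (u i \<bullet> (QM *v u i)))"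
    unfolding sums(2)[OF t] using monoD[OF t(2)] by (intro sum.cong refl \<phi>) simp
qed

section \<open>Riemann sums along cadlag paths\<close>

text \<open>
  One-sided limits give local boundedness, and bisection makes it uniform on the compact interval.
\<close>

lemma cadlag_bounded:
  fixes f :: "real \<Rightarrow> 'a::real_normed_vector"
  assumes "cadlag f"
  obtains K where "\<And>s. 0 \<le> s \<Longrightarrow> s \<le> t \<Longrightarrow> norm (f s) \<le> K"
proof (cases "0 \<le> t")
  case True
  define P where "P a b \<longleftrightarrow> (\<exists>K. \<forall>s\<in>{a..b}. 0 \<le> s \<longrightarrow> norm (f s) \<le> K)" for a b
  have "P 0 t"
    using True
  proof (induction rule: Bolzano)
    case (trans a b c)
    from trans(1,2) obtain K1 K2 where "\<forall>s\<in>{a..b}. 0 \<le> s \<longrightarrow> norm (f s) \<le> K1"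
      "\<forall>s\<in>{b..c}. 0 \<le> s \<longrightarrow> norm (f s) \<le> K2"
      unfolding P_def by blast
    then have "\<forall>s\<in>{a..c}. 0 \<le> s \<longrightarrow> norm (f s) \<le> max K1 K2"
      by (metis atLeastAtMost_iff le_max_iff_disj linear)
    then show "P a c" unfolding P_def by blast
  next
    case (local x)
    have "(f \<longlongrightarrow> f x) (at_right x)" using assms local by (simp add: cadlag_def)
    from order_tendstoD(2)[OF tendsto_norm[OF this], of "norm (f x) + 1"]
    obtain b where b: "b > x" "\<And>s. x < s \<Longrightarrow> s < b \<Longrightarrow> norm (f s) < norm (f x) + 1"
      by (auto simp: eventually_at_right_field)
    have "\<exists>a<x. \<exists>K. \<forall>s. 0 \<le> s \<longrightarrow> a < s \<longrightarrow> s < x \<longrightarrow> norm (f s) \<le> K"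
    proof (cases "x = 0")
      case True
      then show ?thesis by (intro exI[of _ "-1"]) auto
    next
      case False
      then have "0 < x" using local by simp
      then obtain l where "(f \<longlongrightarrow> l) (at_left x)" using assms unfolding cadlag_def by blast
      from order_tendstoD(2)[OF tendsto_norm[OF this], of "norm l + 1"]
      obtain a where "a < x" "\<And>s. a < s \<Longrightarrow> s < x \<Longrightarrow> norm (f s) < norm l + 1"
        by (auto simp: eventually_at_left_field)
      then show ?thesis by (meson less_imp_le)
    qed
    then obtain a K where a: "a < x" "\<And>s. 0 \<le> s \<Longrightarrow> a < s \<Longrightarrow> s < x \<Longrightarrow> norm (f s) \<le> K" by blast
    show "\<exists>d>0. \<forall>a b. a \<le> x \<and> x \<le> b \<and> b - a < d \<longrightarrow> P a b"
    proof (intro exI[of _ "min (x - a) (b - x)"] conjI allI impI)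
      fix a' b' assume *: "a' \<le> x \<and> x \<le> b' \<and> b' - a' < min (x - a) (b - x)"
      have "norm (f s) \<le> max K (norm (f x) + 1)" if "s \<in> {a'..b'}" "0 \<le> s" for s
      proof -
        consider "s < x" | "s = x" | "x < s" by linarith
        then show ?thesis
        proof cases
          case 1 then show ?thesis using a(2)[of s] that * by auto
        next
          case 3 then show ?thesis using b(2)[of s] that * by auto
        qed auto
      qed
      then show "P a' b'" unfolding P_def by blast
    qed (use a b in auto)
  qed
  then obtain K where "\<forall>s\<in>{0..t}. 0 \<le> s \<longrightarrow> norm (f s) \<le> K" unfolding P_def by blast
  then show ?thesis by (intro that) auto
qed (use that in auto)

text \<open>
  The real line is divided into the cells \<open>(i d, (i + 1) d]\<close>. The right end point of the cell of \<open>s\<close> is used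
  because it approaches \<open>s\<close> from the right, where a cadlag path is continuous.
\<close>

definition cell_end :: "real \<Rightarrow> real \<Rightarrow> real" where
  "cell_end d s = d * of_int \<lceil>s / d\<rceil>"

lemma cell_end_bounds:
  assumes "d > 0"
  shows "s \<le> cell_end d s" "cell_end d s < s + d"
proof -
  have "s / d \<le> of_int \<lceil>s / d\<rceil>" "of_int \<lceil>s / d\<rceil> < s / d + 1" by linarith+
  then have "s / d * d \<le> of_int \<lceil>s / d\<rceil> * d" "of_int \<lceil>s / d\<rceil> * d < (s / d + 1) * d"
    using assms by (simp_all only: mult_le_cancel_right_pos mult_less_cancel_right_pos)
  then show "s \<le> cell_end d s" "cell_end d s < s + d"
    using assms by (simp_all add: cell_end_def algebra_simps)
qed

lemma cell_end_eq:
  assumes "d > 0" "s \<in> {real i * d<..real (Suc i) * d}"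
  shows "cell_end d s = real (Suc i) * d"
proof -
  have "\<lceil>s / d\<rceil> = int (Suc i)"
    using assms by (intro ceiling_unique) (simp_all add: field_simps)
  then show ?thesis by (simp add: cell_end_def)
qed

lemma cell_end_in:
  assumes "d > 0" "s \<in> {0<..real n * d}"
  shows "cell_end d s \<le> real n * d" "0 \<le> cell_end d s - d"
proof -
  have "0 < s / d" "s / d \<le> real n" using assms by (simp_all add: field_simps)
  then have "\<lceil>s / d\<rceil> \<le> int n" "1 \<le> \<lceil>s / d\<rceil>" by linarith+
  then have "of_int \<lceil>s / d\<rceil> \<le> real n" "(1::real) \<le> of_int \<lceil>s / d\<rceil>" by linarith+
  then show "cell_end d s \<le> real n * d" "0 \<le> cell_end d s - d"
    using assms by (simp_all add: cell_end_def mult.commute)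
qed

lemma cell_end_tendsto:
  assumes "t > 0"
  shows "(\<lambda>n. cell_end (t / real (Suc n)) s) \<longlonglongrightarrow> s"
proof (rule tendsto_sandwich)
  have pos: "t / real (Suc n) > 0" for n using assms by simp
  show "\<forall>\<^sub>F n in sequentially. s \<le> cell_end (t / real (Suc n)) s"
    using cell_end_bounds(1)[OF pos] by (simp del: of_nat_Suc)
  show "\<forall>\<^sub>F n in sequentially. cell_end (t / real (Suc n)) s \<le> s + t / real (Suc n)"
    using cell_end_bounds(2)[OF pos] by (simp add: less_imp_le del: of_nat_Suc)
  have "(\<lambda>n. t / real (Suc n)) \<longlonglongrightarrow> 0"
    using LIMSEQ_Suc[OF lim_const_over_n[of t]] .
  from tendsto_add[OF tendsto_const this, of s] show "(\<lambda>n. s + t / real (Suc n)) \<longlonglongrightarrow> s" by simp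
qed simp

text \<open>
  The function depends on \<open>s\<close> only through an integer, and every function of an integer is measurable.
\<close>

lemma measurable_comp_cell_end:
  fixes z :: "real \<Rightarrow> 'a::topological_space"
  shows "(\<lambda>s. z (cell_end d s)) \<in> borel_measurable borel"
proof -
  have "(\<lambda>s::real. \<lceil>s / d\<rceil>) \<in> measurable borel (count_space UNIV)" by measurable
  then have "(\<lambda>k. z (d * of_int k)) \<circ> (\<lambda>s::real. \<lceil>s / d\<rceil>) \<in> borel_measurable borel"
    by (rule measurable_comp) simp
  then show ?thesis by (simp add: comp_def cell_end_def)
qed

lemma set_integral_cells:
  fixes F :: "real \<Rightarrow> real \<Rightarrow> 'a::{banach, second_countable_topology}"
  assumes d: "d > 0"
    and int: "\<And>i. i < n \<Longrightarrow> set_integrable lborel {real i * d<..real (Suc i) * d} (F (real (Suc i) * d))"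
  shows "set_integrable lborel {0<..real n * d} (\<lambda>s. F (cell_end d s) s)"
    and "(\<Sum>i<n. LBINT s:{real i * d<..real (Suc i) * d}. F (real (Suc i) * d) s)
      = (LBINT s:{0<..real n * d}. F (cell_end d s) s)"
proof -
  let ?G = "\<lambda>s. F (cell_end d s) s"
  have "set_integrable lborel {0<..real n * d} ?G \<and>
    (\<Sum>i<n. LBINT s:{real i * d<..real (Suc i) * d}. F (real (Suc i) * d) s) = (LBINT s:{0<..real n * d}. ?G s)"
    using int
  proof (induction n)
    case (Suc n)
    let ?c = "{real n * d<..real (Suc n) * d}"
    have G: "?G s = F (real (Suc n) * d) s" if "s \<in> ?c" for s
      using cell_end_eq[OF d that] by simp
    have U: "{0<..real (Suc n) * d} = {0<..real n * d} \<union> ?c" "{0<..real n * d} \<inter> ?c = {}"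
      using d by (auto simp: algebra_simps add_pos_nonneg)
        (smt (verit) mult_nonneg_nonneg of_nat_0_le_iff)+
    have i: "set_integrable lborel ?c ?G"
      using Suc.prems[of n] set_integrable_cong[of lborel lborel ?c ?c ?G "F (real (Suc n) * d)", OF refl refl G]
      by simp
    have j: "set_integrable lborel {0<..real n * d} ?G" using Suc by auto
    have "(LBINT s:?c. ?G s) = (LBINT s:?c. F (real (Suc n) * d) s)"
      using G by (intro set_lebesgue_integral_cong) auto
    then show ?case
      unfolding U(1) set_integral_Un[OF U(2) j i] sum.lessThan_Suc
      using Suc set_integrable_Un[OF j i] by auto
  qed (simp add: set_integrable_def set_lebesgue_integral_def)
  then show "set_integrable lborel {0<..real n * d} ?G"
    "(\<Sum>i<n. LBINT s:{real i * d<..real (Suc i) * d}. F (real (Suc i) * d) s) = (LBINT s:{0<..real n * d}. ?G s)"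
    by auto
qed

lemma set_integral_Ioc_eq_Icc:
  fixes f :: "real \<Rightarrow> 'a::{banach, second_countable_topology}"
  assumes f: "set_integrable lborel {a..b} f" and "a \<le> b"
  shows "set_integrable lborel {a<..b} f" "(LBINT s:{a<..b}. f s) = (LBINT s:{a..b}. f s)"
proof -
  show i: "set_integrable lborel {a<..b} f"
    using f by (rule set_integrable_subset) auto
  have "AE s in lborel. indicator {a<..b} s *\<^sub>R f s = indicator {a..b} s *\<^sub>R f s"
    using AE_lborel_singleton[of a] by eventually_elim (auto simp: indicator_def)
  then show "(LBINT s:{a<..b}. f s) = (LBINT s:{a..b}. f s)"
    unfolding set_lebesgue_integral_def using i f
    by (intro integral_cong_AE) (auto simp: set_integrable_def)
qed

lemma set_integral_Ioc_eq_diff: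
  fixes f :: "real \<Rightarrow> 'a::{banach, second_countable_topology}"
  assumes f: "set_integrable lborel {0..b} f" and "0 \<le> a" "a \<le> b"
  shows "(LBINT s:{a<..b}. f s) = (LBINT s:{0..b}. f s) - (LBINT s:{0..a}. f s)"
proof -
  have "{0..b} = {0..a} \<union> {a<..b}" "{0..a} \<inter> {a<..b} = {}" using assms by auto
  moreover have "set_integrable lborel {0..a} f" "set_integrable lborel {a<..b} f"
    using assms by (auto intro: set_integrable_subset[OF f])
  ultimately show ?thesis by (simp add: set_integral_Un)
qed

text \<open>
  The nodes run backwards from \<open>t\<close>, as they do in the stochastic convolution. Reversing the order of summation
  writes the sum as the integral of \<open>g\<close> at right end points of cells.
\<close>

lemma riemann_sum_tendsto:
  fixes g :: "real \<Rightarrow> real"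
  assumes t: "t > 0" and cont: "continuous_on UNIV g"
  shows "(\<lambda>n. \<Sum>i<Suc n. t / real (Suc n) * g (t - real i * (t / real (Suc n)))) \<longlonglongrightarrow> (LBINT s:{0..t}. g s)"
proof -
  define d where "d n = t / real (Suc n)" for n
  have d: "d n > 0" "real (Suc n) * d n = t" for n using t by (simp_all add: d_def del: of_nat_Suc)
  have "bounded (g ` {0..t})"
    using continuous_on_subset[OF cont] by (intro compact_imp_bounded compact_continuous_image) auto
  then obtain K where K: "\<And>s. 0 \<le> s \<Longrightarrow> s \<le> t \<Longrightarrow> norm (g s) \<le> K"
    unfolding bounded_iff by fastforce
  have meas[measurable]: "g \<in> borel_measurable borel" by (rule borel_measurable_continuous_onI[OF cont])
  have Icc: "set_integrable lborel {0..t} g"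
    by (rule borel_integrable_atLeastAtMost') (rule continuous_on_subset[OF cont], simp)
  have eq: "(\<Sum>i<Suc n. t / real (Suc n) * g (t - real i * (t / real (Suc n))))
      = (LBINT s:{0<..t}. g (cell_end (d n) s))" for n
  proof -
    have "(\<Sum>i<Suc n. t / real (Suc n) * g (t - real i * (t / real (Suc n))))
        = (\<Sum>i<Suc n. d n * g (real (Suc n - i) * d n))"
      by (intro sum.cong refl) (simp add: d(2)[of n, symmetric] d_def[symmetric] of_nat_diff algebra_simps del: of_nat_Suc)
    also have "\<dots> = (\<Sum>i<Suc n. d n * g (real (Suc n - (Suc n - Suc i)) * d n))"
      by (rule sum.nat_diff_reindex[symmetric])
    also have "\<dots> = (\<Sum>i<Suc n. d n * g (real (Suc i) * d n))"
      by (intro sum.cong refl) (simp add: Suc_diff_Suc del: of_nat_Suc)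
    also have "\<dots> = (\<Sum>i<Suc n. LBINT s:{real i * d n<..real (Suc i) * d n}. g (real (Suc i) * d n))"
      using d(1)[of n] by (intro sum.cong refl) (simp add: set_integral_const algebra_simps)
    also have "\<dots> = (LBINT s:{0<..real (Suc n) * d n}. g (cell_end (d n) s))"
      using d(1)[of n]
      by (intro set_integral_cells(2)[where F = "\<lambda>e s. g e"]) (auto simp: set_integrable_def)
    finally show ?thesis by (simp only: d(2))
  qed
  have "(\<lambda>n. LBINT s:{0<..t}. g (cell_end (d n) s)) \<longlonglongrightarrow> (LBINT s:{0<..t}. g s)"
    unfolding set_lebesgue_integral_def
  proof (rule integral_dominated_convergence)
    show "integrable lborel (\<lambda>s. indicator {0<..t} s *\<^sub>R K)" using t by simp
    show "(\<lambda>s. indicator {0<..t} s *\<^sub>R g s) \<in> borel_measurable lborel" by measurable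
    show "(\<lambda>s. indicator {0<..t} s *\<^sub>R g (cell_end (d n) s)) \<in> borel_measurable lborel" for n
      using measurable_comp_cell_end[of g "d n"] by measurable
    have "(\<lambda>n. g (cell_end (d n) s)) \<longlonglongrightarrow> g s" for s
      using continuous_on_tendsto_compose[OF cont cell_end_tendsto[OF t, of s]] by (simp add: d_def)
    then show "AE s in lborel. (\<lambda>n. indicator {0<..t} s *\<^sub>R g (cell_end (d n) s)) \<longlonglongrightarrow> indicator {0<..t} s *\<^sub>R g s"
      by (intro AE_I2 tendsto_intros)
    have "norm (g (cell_end (d n) s)) \<le> K" if "s \<in> {0<..t}" for s n
      using cell_end_in[OF d(1)[of n], of s "Suc n"] that d(1)[of n] unfolding d(2) by (intro K) auto
    then show "AE s in lborel. norm (indicator {0<..t} s *\<^sub>R g (cell_end (d n) s)) \<le> indicator {0<..t} s *\<^sub>R K" for n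
      by (intro AE_I2) (auto simp: indicator_def)
  qed
  then show ?thesis
    unfolding eq set_integral_Ioc_eq_Icc(2)[OF Icc less_imp_le[OF t]] .
qed

lemma bounded_bilinear_matrix_vector_mult: "bounded_bilinear ((*v) :: real^'n^'m \<Rightarrow> real^'n \<Rightarrow> real^'m)"
  unfolding bilinear_conv_bounded_bilinear[symmetric] bilinear_def
  by (intro conjI allI linearI)
    (simp_all add: vec_eq_iff matrix_vector_mult_def sum_distrib_left sum.distrib algebra_simps)

lemma borel_measurable_matrix_vector_mult:
  fixes F :: "'a \<Rightarrow> real^'n^'m" and v :: "'a \<Rightarrow> real^'n"
  assumes "F \<in> borel_measurable M" "v \<in> borel_measurable M"
  shows "(\<lambda>s. F s *v v s) \<in> borel_measurable M"
  by (rule borel_measurable_continuous_Pair[OF assms])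
    (intro bounded_bilinear.continuous_on[OF bounded_bilinear_matrix_vector_mult] continuous_intros)

lemma set_borel_measurable_cadlag:
  fixes z :: "real \<Rightarrow> 'a::{real_normed_vector, second_countable_topology}"
  assumes z: "cadlag z" and t: "0 < t"
  shows "(\<lambda>s. indicator {0<..t} s *\<^sub>R z s) \<in> borel_measurable borel"
    and "0 \<le> s \<Longrightarrow> (\<lambda>n. z (cell_end (t / real (Suc n)) s)) \<longlonglongrightarrow> z s"
proof -
  show lim: "(\<lambda>n. z (cell_end (t / real (Suc n)) s)) \<longlonglongrightarrow> z s" if "0 \<le> s" for s
  proof -
    have "continuous (at s within {s..}) z"
      using z that by (simp add: continuous_within at_within_Ici_at_right cadlag_def)
    then show ?thesis
    proof (rule continuous_within_tendsto_compose'[OF _ _ cell_end_tendsto[OF t]])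
      show "cell_end (t / real (Suc n)) s \<in> {s..}" for n
        using cell_end_bounds(1)[of "t / real (Suc n)" s] t by (simp del: of_nat_Suc)
    qed
  qed
  show "(\<lambda>s. indicator {0<..t} s *\<^sub>R z s) \<in> borel_measurable borel"
  proof (rule borel_measurable_LIMSEQ_metric)
    show "(\<lambda>s. indicator {0<..t} s *\<^sub>R z (cell_end (t / real (Suc n)) s)) \<in> borel_measurable borel" for n
      using measurable_comp_cell_end[of z "t / real (Suc n)"] by measurable
    show "(\<lambda>n. indicator {0<..t} s *\<^sub>R z (cell_end (t / real (Suc n)) s)) \<longlonglongrightarrow> indicator {0<..t} s *\<^sub>R z s" for s
      using lim[of s] by (cases "s \<in> {0<..t}") auto
  qed
qed

text \<open>
  The sums approximate the stochastic convolution \<open>\<integral> C exp((t - s) A) B dm(s)\<close>, and the statement is the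
  variation of constants formula along one path. With \<open>H(s) = C exp((t - s) A)\<close>, so that \<open>H' = - H A\<close>, the
  integral equation replaces \<open>B dm\<close> by \<open>dz - A z ds\<close>, and summation by parts moves the difference from \<open>z\<close>
  to \<open>H\<close>. What remains, besides the boundary term \<open>C z(t)\<close>, is the integral of
  \<open>H(s) A z(s\<^sub>+) - H(s\<^sub>-) A z(s)\<close>, where \<open>s\<^sub>-\<close> and \<open>s\<^sub>+\<close> are the ends of the cell of \<open>s\<close>. It vanishes in the limit
  because \<open>H\<close> is continuous and \<open>z\<close> is right-continuous and bounded.
\<close>

lemma sde_riemann_sum_tendsto:
  fixes A :: "real^'k^'k" and B :: "real^'m^'k" and C :: "real^'k^'p" and z :: "real \<Rightarrow> real^'k"
  assumes z: "cadlag z" and t: "0 < t"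
    and sde: "\<And>s. 0 \<le> s \<Longrightarrow> z s = (LBINT r:{0..s}. A *v z r) + B *v (m s - m 0)"
  shows "(\<lambda>n. \<Sum>i<Suc n. (C ** mat_exp ((t - real i * (t / real (Suc n))) *\<^sub>R A) ** B) *v
      (m (real (Suc i) * (t / real (Suc n))) - m (real i * (t / real (Suc n))))) \<longlonglongrightarrow> C *v z t"
proof -
  define d where "d n = t / real (Suc n)" for n
  have d: "d n > 0" "real (Suc n) * d n = t" for n using t by (simp_all add: d_def del: of_nat_Suc)
  note bbv = bounded_bilinear_matrix_vector_mult
  define H where "H s = C ** mat_exp ((t - s) *\<^sub>R A)" for s
  have H_t: "H t = C" by (simp add: H_def mat_exp_zero[of A, simplified])
  have dH: "(H has_vector_derivative - (H s ** A)) (at s within S)" for s S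
  proof -
    have "((\<lambda>s. t - s) has_vector_derivative - 1) (at s within S)"
      by (auto intro!: derivative_eq_intros)
    from vector_diff_chain_within[OF this mat_exp_has_vector_derivative[of A]]
    have "((\<lambda>s. mat_exp ((t - s) *\<^sub>R A)) has_vector_derivative - (A ** mat_exp ((t - s) *\<^sub>R A))) (at s within S)"
      by (simp add: comp_def)
    from bounded_linear.has_vector_derivative[OF
        bounded_bilinear.bounded_linear_right[OF bounded_bilinear_matrix_mult] this, of C]
    show ?thesis
      unfolding H_def by (simp add: matrix_mult_minus_right mat_exp_mult_commute matrix_mul_assoc[symmetric])
  qed
  have contH: "continuous_on S H" for S
    by (rule continuous_on_vector_derivative) (rule dH)
  obtain K where K: "\<And>s. 0 \<le> s \<Longrightarrow> s \<le> t \<Longrightarrow> norm (z s) \<le> K"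
    using cadlag_bounded[OF z] by blast
  have "bounded (H ` {0..t})"
    by (intro compact_imp_bounded compact_continuous_image contH) auto
  then obtain KH where KH: "\<And>s. 0 \<le> s \<Longrightarrow> s \<le> t \<Longrightarrow> norm (H s) \<le> KH"
    unfolding bounded_iff by fastforce
  obtain J where J: "0 < J" "\<And>(X::real^'k^'p) v. norm (X *v v) \<le> norm X * norm v * J"
    using bounded_bilinear.pos_bounded[OF bbv] by blast
  obtain J' where J': "0 < J'" "\<And>(X::real^'k^'k) v. norm (X *v v) \<le> norm X * norm v * J'"
    using bounded_bilinear.pos_bounded[OF bbv] by blast
  note z_meas = set_borel_measurable_cadlag(1)[OF z t]
  have blA: "bounded_linear ((*v) X)" for X :: "real^'k^'q"
    by (rule bounded_bilinear.bounded_linear_right[OF bbv])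
  have Az_int: "set_integrable lborel {0..t} (\<lambda>r. A *v z r)"
    unfolding set_integrable_def
  proof (rule Bochner_Integration.integrable_bound)
    show "integrable lborel (\<lambda>s. indicator {0..t} s *\<^sub>R (norm A * K * J'))" using t by simp
    have "indicator {0..t} s *\<^sub>R (A *v z s)
        = A *v (indicator {0<..t} s *\<^sub>R z s + indicator {0} s *\<^sub>R z 0)" for s
      using t by (auto simp: indicator_def)
    then show "(\<lambda>s. indicator {0..t} s *\<^sub>R (A *v z s)) \<in> borel_measurable lborel"
      using z_meas by (simp add: borel_measurable_matrix_vector_mult)
    have "norm (A *v z s) \<le> norm A * K * J'" if "s \<in> {0..t}" for s
      using J'(2)[of A "z s"] K[of s] that J'(1)
      by (meson atLeastAtMost_iff less_imp_le mult_left_mono mult_right_mono norm_ge_zero order_trans)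
    then show "AE s in lborel. norm (indicator {0..t} s *\<^sub>R (A *v z s)) \<le> norm (indicator {0..t} s *\<^sub>R (norm A * K * J'))"
      by (intro AE_I2) (auto simp: indicator_def intro: order_trans[OF _ abs_ge_self])
  qed
  have Az_int': "set_integrable lborel {0..b} (\<lambda>r. A *v z r)" if "b \<le> t" for b
    using Az_int by (rule set_integrable_subset) (use that in auto)
  have z0: "z 0 = 0"
    using sde[of 0] set_integral_Ioc_eq_Icc(2)[OF Az_int'[of 0]] t
    by (simp add: set_lebesgue_integral_def)
  have increment: "B *v (m b - m a) = z b - z a - (LBINT r:{a<..b}. A *v z r)" if "0 \<le> a" "a \<le> b" "b \<le> t" for a b
    using sde[of a] sde[of b] set_integral_Ioc_eq_diff[OF Az_int'[OF that(3)] that(1,2)] that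
    by (simp add: matrix_vector_mult_diff_distrib)
  define G where "G n e s = H s *v (A *v z e) - H (e - d n) *v (A *v z s)" for n e s
  have HAz_int: "set_integrable lborel {0..t} (\<lambda>s. H s *v (A *v v))"
    and XAz_int: "set_integrable lborel {0..t} (\<lambda>s. X *v (A *v z s))" for v and X :: "real^'k^'p"
  proof -
    show "set_integrable lborel {0..t} (\<lambda>s. H s *v (A *v v))"
      by (intro borel_integrable_atLeastAtMost' bounded_bilinear.continuous_on[OF bbv] contH continuous_on_const)
    show "set_integrable lborel {0..t} (\<lambda>s. X *v (A *v z s))"
      using integrable_bounded_linear[OF blA[of X] Az_int[unfolded set_integrable_def]]
      by (simp add: set_integrable_def matrix_vector_mult_scaleR)
  qed
  have G_int: "set_integrable lborel {a<..b} (G n e)" if "0 \<le> a" "b \<le> t" for n e a b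
    unfolding G_def
    by (intro set_integral_diff(1) set_integrable_subset[OF HAz_int] set_integrable_subset[OF XAz_int])
      (use that in auto)
  define tt where "tt n i = real i * d n" for n i
  \<comment> \<open>Summation by parts on one cell.\<close>
  have step: "(H a ** B) *v (m b - m a) = H b *v z b - H a *v z a
      + (LBINT s:{a<..b}. H s *v (A *v z b) - H a *v (A *v z s))" if ab: "0 \<le> a" "a \<le> b" "b \<le> t" for a b
  proof -
    have sub: "set_integrable lborel {a..b} f" if "set_integrable lborel {0..t} f" for f :: "real \<Rightarrow> real^'p"
      using that by (rule set_integrable_subset) (use ab in auto)
    have sub': "set_integrable lborel {a<..b} f" if "set_integrable lborel {0..t} f" for f :: "real \<Rightarrow> real^'p"
      using that by (rule set_integrable_subset) (use ab in auto)
    have "((\<lambda>s. - (H s *v z b)) has_vector_derivative H s *v (A *v z b)) (at s within {a..b})" for s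
      using bounded_linear.has_vector_derivative[OF bounded_bilinear.bounded_linear_left[OF bbv] dH, of "- z b" s "{a..b}"]
      by (simp add: matrix_vector_mult_minus_left matrix_vector_mult_minus_right matrix_vector_mul_assoc)
    from has_set_integral_FTC(2)[OF ab(2) this]
    have "(LBINT s:{a..b}. H s *v (A *v z b)) = H a *v z b - H b *v z b"
      by (simp add: bounded_bilinear.continuous_on[OF bbv] contH)
    then have 1: "(LBINT s:{a<..b}. H s *v (A *v z b)) = H a *v z b - H b *v z b"
      by (simp add: set_integral_Ioc_eq_Icc(2)[OF sub[OF HAz_int] ab(2)])
    have "set_integrable lborel {a<..b} (\<lambda>r. A *v z r)"
      using Az_int by (rule set_integrable_subset) (use ab in auto)
    from integral_bounded_linear[OF blA[of "H a"] this[unfolded set_integrable_def]]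
    have 2: "(LBINT s:{a<..b}. H a *v (A *v z s)) = H a *v (LBINT s:{a<..b}. A *v z s)"
      by (simp add: set_lebesgue_integral_def matrix_vector_mult_scaleR)
    show ?thesis
      unfolding set_integral_diff(2)[OF sub'[OF HAz_int] sub'[OF XAz_int]] 1 2
        matrix_vector_mul_assoc[symmetric] increment[OF ab]
      by (simp add: matrix_vector_mult_diff_distrib)
  qed
  have tt: "0 \<le> tt n i" "tt n i \<le> tt n (Suc i)" "tt n (Suc i) - d n = tt n i" for n i
    using d(1)[of n] by (simp_all add: tt_def algebra_simps)
  have tt_le: "tt n (Suc i) \<le> t" if "i < Suc n" for n i
    unfolding tt_def d(2)[of n, symmetric] using d(1)[of n] that by (intro mult_right_mono) auto
  have sum_eq: "(\<Sum>i<Suc n. (H (tt n i) ** B) *v (m (tt n (Suc i)) - m (tt n i)))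
      = C *v z t + (LBINT s:{0<..t}. G n (cell_end (d n) s) s)" for n
  proof -
    have "(\<Sum>i<Suc n. (H (tt n i) ** B) *v (m (tt n (Suc i)) - m (tt n i)))
      = (\<Sum>i<Suc n. H (tt n (Suc i)) *v z (tt n (Suc i)) - H (tt n i) *v z (tt n i)
          + (LBINT s:{tt n i<..tt n (Suc i)}. G n (tt n (Suc i)) s))"
      using step[OF tt(1,2) tt_le] by (intro sum.cong refl) (simp add: G_def tt(3))
    also have "\<dots> = (H (tt n (Suc n)) *v z (tt n (Suc n)) - H (tt n 0) *v z (tt n 0))
        + (\<Sum>i<Suc n. LBINT s:{tt n i<..tt n (Suc i)}. G n (tt n (Suc i)) s)"
      unfolding sum.distrib sum_lessThan_telescope[of "\<lambda>i. H (tt n i) *v z (tt n i)"] ..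
    also have "tt n (Suc n) = t" by (simp only: tt_def d(2))
    also have "(\<Sum>i<Suc n. LBINT s:{tt n i<..tt n (Suc i)}. G n (tt n (Suc i)) s)
        = (LBINT s:{0<..t}. G n (cell_end (d n) s) s)"
      using set_integral_cells(2)[OF d(1)[of n], of "Suc n" "G n"] G_int[OF tt(1) tt_le, of _ n]
      unfolding d(2) tt_def by blast
    finally show ?thesis by (simp add: H_t tt_def z0)
  qed
  have "(\<lambda>n. LBINT s:{0<..t}. G n (cell_end (d n) s) s) \<longlonglongrightarrow> (LBINT s:{0<..t}. 0)"
    unfolding set_lebesgue_integral_def
  proof (rule integral_dominated_convergence)
    define c where "c = 2 * (KH * (norm A * K * J') * J)"
    show "integrable lborel (\<lambda>s. indicator {0<..t} s *\<^sub>R c)" using t by simp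
    show "(\<lambda>s. indicator {0<..t} s *\<^sub>R (0 :: real^'p)) \<in> borel_measurable lborel" by simp
    have "set_integrable lborel {0<..t} (\<lambda>s. G n (cell_end (d n) s) s)" for n
      using set_integral_cells(1)[OF d(1)[of n], of "Suc n" "G n"] G_int[OF tt(1) tt_le, of _ n]
      unfolding d(2) tt_def by blast
    then show "(\<lambda>s. indicator {0<..t} s *\<^sub>R G n (cell_end (d n) s) s) \<in> borel_measurable lborel" for n
      by (simp add: set_integrable_def)
    have le: "norm (H s *v (A *v z r)) \<le> KH * (norm A * K * J') * J" if "0 \<le> s" "s \<le> t" "0 \<le> r" "r \<le> t" for s r
    proof -
      have "0 \<le> K" using K[of 0] t norm_ge_zero[of "z 0"] by linarith
      have "0 \<le> KH" using KH[of 0] t norm_ge_zero[of "H 0"] by linarith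
      have "norm (A *v z r) \<le> norm A * norm (z r) * J'" by (rule J')
      also have "\<dots> \<le> norm A * K * J'"
        using K[OF that(3,4)] J'(1) by (intro mult_right_mono mult_left_mono) auto
      finally have Azr: "norm (A *v z r) \<le> norm A * K * J'" .
      have "norm (H s *v (A *v z r)) \<le> norm (H s) * norm (A *v z r) * J" by (rule J)
      also have "\<dots> \<le> KH * (norm A * K * J') * J"
        using KH[OF that(1,2)] Azr J(1) J'(1) \<open>0 \<le> KH\<close> by (intro mult_right_mono mult_mono) auto
      finally show ?thesis .
    qed
    have "norm (G n (cell_end (d n) s) s) \<le> c" if "s \<in> {0<..t}" for s n
    proof -
      have "cell_end (d n) s \<le> t" "0 \<le> cell_end (d n) s - d n"
        using cell_end_in[OF d(1)[of n], of s "Suc n"] that unfolding d(2) by auto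
      then show ?thesis
        unfolding G_def c_def using that d(1)[of n]
        by (intro order_trans[OF norm_triangle_ineq4] order_trans[OF add_mono[OF le le]]) auto
    qed
    then show "AE s in lborel. norm (indicator {0<..t} s *\<^sub>R G n (cell_end (d n) s) s) \<le> indicator {0<..t} s *\<^sub>R c" for n
      by (intro AE_I2) (auto simp: indicator_def)
    have lim: "(\<lambda>n. G n (cell_end (d n) s) s) \<longlonglongrightarrow> 0" if "0 \<le> s" for s
    proof -
      note bt = bounded_bilinear.tendsto[OF bbv]
      have "d \<longlonglongrightarrow> 0"
        unfolding d_def using LIMSEQ_Suc[OF lim_const_over_n[of t]] .
      from tendsto_diff[OF cell_end_tendsto[OF t, of s] this]
      have "(\<lambda>n. cell_end (d n) s - d n) \<longlonglongrightarrow> s" by (simp add: d_def)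
      then have "(\<lambda>n. H (cell_end (d n) s - d n)) \<longlonglongrightarrow> H s"
        by (rule continuous_on_tendsto_compose[OF contH[of UNIV]]) auto
      moreover have "(\<lambda>n. z (cell_end (d n) s)) \<longlonglongrightarrow> z s"
        unfolding d_def by (rule set_borel_measurable_cadlag(2)[OF z t that])
      ultimately have "(\<lambda>n. G n (cell_end (d n) s) s) \<longlonglongrightarrow> H s *v (A *v z s) - H s *v (A *v z s)"
        unfolding G_def by (intro tendsto_diff bt tendsto_const)
      then show ?thesis by simp
    qed
    show "AE s in lborel. (\<lambda>n. indicator {0<..t} s *\<^sub>R G n (cell_end (d n) s) s) \<longlonglongrightarrow> indicator {0<..t} s *\<^sub>R 0"
      using lim by (intro AE_I2) (auto simp: indicator_def)
  qed
  then have "(\<lambda>n. C *v z t + (LBINT s:{0<..t}. G n (cell_end (d n) s) s)) \<longlonglongrightarrow> C *v z t + 0"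
    by (intro tendsto_intros) (simp add: set_lebesgue_integral_def)
  then show ?thesis
    unfolding sum_eq[symmetric] by (simp add: H_def tt_def d_def)
qed

section \<open>The error bound\<close>

text \<open>
  Jensen's inequality for the square, in the form that the variance of the norm is nonnegative.
\<close>

lemma (in prob_space) nn_integral_norm_le_sqrt:
  fixes Y :: "'a \<Rightarrow> 'b::{real_normed_vector, second_countable_topology}"
  assumes [measurable]: "Y \<in> borel_measurable M" and b: "0 \<le> b"
    and le: "(\<integral>\<^sup>+ w. ennreal ((norm (Y w))\<^sup>2) \<partial>M) \<le> ennreal b"
  shows "(\<integral>\<^sup>+ w. ennreal (norm (Y w)) \<partial>M) \<le> ennreal (sqrt b)"
proof -
  have int2: "integrable M (\<lambda>w. (norm (Y w))\<^sup>2)"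
    using le by (intro integrableI_bounded) (auto intro: le_less_trans)
  have int: "integrable M (\<lambda>w. norm (Y w))"
    by (rule square_integrable_imp_integrable[OF _ int2]) simp
  have "(expectation (\<lambda>w. norm (Y w)))\<^sup>2 \<le> expectation (\<lambda>w. (norm (Y w))\<^sup>2)"
    using variance_eq[OF int int2] variance_positive[of "\<lambda>w. norm (Y w)"] by simp
  also have "\<dots> \<le> b"
    using le b nn_integral_eq_integral[OF int2] by simp
  finally have "expectation (\<lambda>w. norm (Y w)) \<le> sqrt b"
    by (rule real_le_rsqrt)
  then show ?thesis
    using nn_integral_eq_integral[OF int] by (simp add: ennreal_leI)
qed

text \<open>
  The grid sums converge almost surely to the output error, and their second moments are Riemann sums that
  converge to the integral. Fatou's lemma passes the bound to the limit.
\<close>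

lemma output_error_second_moment:
  fixes M :: "real \<Rightarrow> 'w \<Rightarrow> real^'m"
    and A :: "real^'n^'n" and B :: "real^'m^'n" and C :: "real^'n^'p"
    and Ar :: "real^'r^'r" and Br :: "real^'m^'r" and Cr :: "real^'r^'p"
  defines "E \<equiv> \<lambda>s. C ** mat_exp (s *\<^sub>R A) ** B - Cr ** mat_exp (s *\<^sub>R Ar) ** Br"
  assumes Pr: "prob_space Pr" and levy: "levy_process Pr M"
    and sq: "square_integrable_process Pr M" and zero: "mean_zero_process Pr M"
    and QM: "QM = second_moment_matrix Pr (M 1)"
    and x: "linear_sde_solution Pr A B M 0 x" and xr: "linear_sde_solution Pr Ar Br M 0 xr"
    and cont: "continuous_on UNIV (\<lambda>s. trace (E s ** QM ** transpose (E s)))" and t: "0 < t"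
  shows "(\<integral>\<^sup>+ w. ennreal ((norm (C *v x t w - Cr *v xr t w))\<^sup>2) \<partial>Pr)
    \<le> ennreal (LBINT s:{0..t}. trace (E s ** QM ** transpose (E s)))"
proof -
  interpret prob_space Pr by fact
  define g where "g s = trace (E s ** QM ** transpose (E s))" for s
  define d where "d n = t / real (Suc n)" for n
  have d: "0 < d n" for n using t by (simp add: d_def del: of_nat_Suc)
  define \<tau> where "\<tau> n i = real i * d n" for n i
  have mono: "mono (\<tau> n)" for n
    using d[of n] by (auto simp: \<tau>_def mono_def intro!: mult_right_mono)
  define D where "D n w = (\<Sum>i<Suc n. E (t - \<tau> n i) *v (M (\<tau> n (Suc i)) w - M (\<tau> n i) w))" for n w
  have meas: "M s \<in> borel_measurable Pr" if "0 \<le> s" for s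
    using levy that by (simp add: levy_process_def)
  have D_meas[measurable]: "D n \<in> borel_measurable Pr" for n
    unfolding D_def using d[of n]
    by (intro borel_measurable_sum borel_measurable_matrix_vector_mult borel_measurable_diff meas)
      (auto simp: \<tau>_def)
  have ED: "(\<integral>\<^sup>+ w. ennreal ((norm (D n w))\<^sup>2) \<partial>Pr) = ennreal (\<Sum>i<Suc n. d n * g (t - \<tau> n i))" for n
  proof -
    \<comment> \<open>Each coordinate is a weighted sum of increments whose weights are rows of \<open>E\<close>.\<close>
    define u where "u k i = E (t - \<tau> n i) $ k" for k i
    have D_nth: "D n w $ k = (\<Sum>i<Suc n. u k i \<bullet> (M (\<tau> n (Suc i)) w - M (\<tau> n i) w))" for k w
      by (simp add: D_def u_def sum_component matrix_vector_mult_def inner_vec_def del: sum.lessThan_Suc)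
    have 0: "0 \<le> \<tau> n 0" by (simp add: \<tau>_def)
    note mom = levy_weighted_sum_second_moment[OF Pr levy sq zero 0 mono, where n = "Suc n", folded QM]
    have eq: "(norm (D n w))\<^sup>2 = (\<Sum>k\<in>UNIV. (D n w $ k)\<^sup>2)" for w
      unfolding power2_norm_eq_inner by (simp add: inner_vec_def power2_eq_square)
    have int: "integrable Pr (\<lambda>w. (D n w $ k)\<^sup>2)" for k
      unfolding D_nth by (rule mom(1))
    have "(\<integral>\<^sup>+ w. ennreal ((norm (D n w))\<^sup>2) \<partial>Pr) = ennreal (\<integral>w. (norm (D n w))\<^sup>2 \<partial>Pr)"
      unfolding eq using int by (intro nn_integral_eq_integral AE_I2 sum_nonneg) auto
    also have "(\<integral>w. (norm (D n w))\<^sup>2 \<partial>Pr) = (\<Sum>k\<in>UNIV. \<integral>w. (D n w $ k)\<^sup>2 \<partial>Pr)"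
      unfolding eq using int by (intro Bochner_Integration.integral_sum)
    also have "\<dots> = (\<Sum>k\<in>UNIV. \<Sum>i<Suc n. (\<tau> n (Suc i) - \<tau> n i) * (u k i \<bullet> (QM *v u k i)))"
      unfolding D_nth mom(2) ..
    also have "\<dots> = (\<Sum>i<Suc n. d n * g (t - \<tau> n i))"
      by (subst sum.swap) (simp add: g_def trace_sandwich_eq u_def sum_distrib_left \<tau>_def algebra_simps
          del: sum.lessThan_Suc)
    finally show ?thesis .
  qed
  have lim: "(\<lambda>n. \<Sum>i<Suc n. d n * g (t - \<tau> n i)) \<longlonglongrightarrow> (LBINT s:{0..t}. g s)"
    unfolding d_def \<tau>_def by (rule riemann_sum_tendsto[OF t]) (use cont in \<open>simp add: g_def\<close>)
  have path: "AE w in Pr. (\<lambda>n. D n w) \<longlonglongrightarrow> C *v x t w - Cr *v xr t w"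
  proof -
    have "AE w in Pr. cadlag (\<lambda>s. x s w)" "AE w in Pr. cadlag (\<lambda>s. xr s w)"
      "AE w in Pr. \<forall>s\<ge>0. x s w = 0 + (LBINT r:{0..s}. A *v x r w) + B *v (M s w - M 0 w)"
      "AE w in Pr. \<forall>s\<ge>0. xr s w = 0 + (LBINT r:{0..s}. Ar *v xr r w) + Br *v (M s w - M 0 w)"
      using x xr by (auto simp: linear_sde_solution_def)
    then show ?thesis
    proof eventually_elim
      case (elim w)
      have 1: "(\<lambda>n. \<Sum>i<Suc n. (C ** mat_exp ((t - \<tau> n i) *\<^sub>R A) ** B) *v (M (\<tau> n (Suc i)) w - M (\<tau> n i) w)) \<longlonglongrightarrow> C *v x t w"
        unfolding \<tau>_def d_def
        by (rule sde_riemann_sum_tendsto[where m = "\<lambda>s. M s w", OF elim(1) t]) (use elim(3) in simp)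
      have 2: "(\<lambda>n. \<Sum>i<Suc n. (Cr ** mat_exp ((t - \<tau> n i) *\<^sub>R Ar) ** Br) *v (M (\<tau> n (Suc i)) w - M (\<tau> n i) w)) \<longlonglongrightarrow> Cr *v xr t w"
        unfolding \<tau>_def d_def
        by (rule sde_riemann_sum_tendsto[where m = "\<lambda>s. M s w", OF elim(2) t]) (use elim(4) in simp)
      show ?case
        using tendsto_diff[OF 1 2]
        by (simp add: D_def E_def matrix_vector_mult_diff_rdistrib sum_subtractf[symmetric] del: sum.lessThan_Suc)
    qed
  qed
  have "(\<integral>\<^sup>+ w. ennreal ((norm (C *v x t w - Cr *v xr t w))\<^sup>2) \<partial>Pr)
      = (\<integral>\<^sup>+ w. liminf (\<lambda>n. ennreal ((norm (D n w))\<^sup>2)) \<partial>Pr)"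
  proof (rule nn_integral_cong_AE)
    show "AE w in Pr. ennreal ((norm (C *v x t w - Cr *v xr t w))\<^sup>2) = liminf (\<lambda>n. ennreal ((norm (D n w))\<^sup>2))"
      using path
    proof eventually_elim
      case (elim w)
      have "(\<lambda>n. ennreal ((norm (D n w))\<^sup>2)) \<longlonglongrightarrow> ennreal ((norm (C *v x t w - Cr *v xr t w))\<^sup>2)"
        by (intro tendsto_ennrealI tendsto_power tendsto_norm elim)
      then show ?case
        by (intro lim_imp_Liminf[symmetric]) simp_all
    qed
  qed
  also have "\<dots> \<le> liminf (\<lambda>n. \<integral>\<^sup>+ w. ennreal ((norm (D n w))\<^sup>2) \<partial>Pr)"
    by (rule nn_integral_liminf) measurable
  also have "\<dots> = ennreal (LBINT s:{0..t}. g s)"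
    unfolding ED by (intro lim_imp_Liminf tendsto_ennrealI lim) simp
  finally show ?thesis by (simp add: g_def)
qed

theorem theorem2p11:
  fixes Pr :: "'w measure"
    and M :: "real \<Rightarrow> 'w \<Rightarrow> real^'m"
    and A :: "real^('r::{finite,linorder} + 's::{finite,linorder})^('r + 's)"
    and B :: "real^'m^('r + 's)"
    and C :: "real^('r + 's)^'p"
    and QM :: "real^'m^'m"
    and P Q K L U V T At :: "real^('r + 's)^('r + 's)"
    and \<sigma> :: "'r + 's \<Rightarrow> real"
    and A11 Abar :: "real^('r::{finite,linorder})^('r::{finite,linorder})" and A12 :: "real^('s::{finite,linorder})^('r::{finite,linorder})"
    and A21 :: "real^('r::{finite,linorder})^('s::{finite,linorder})" and A22 :: "real^('s::{finite,linorder})^('s::{finite,linorder})"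
    and B1 :: "real^'m^('r::{finite,linorder})" and B2 :: "real^'m^('s::{finite,linorder})"
    and C1 Cbar :: "real^('r::{finite,linorder})^'p" and C2 :: "real^('s::{finite,linorder})^'p"
    and Sigma2 :: "real^('s::{finite,linorder})^('s::{finite,linorder})"
    and Pg :: "real^('r::{finite,linorder})^('r + 's)" and Pg1 :: "real^('r::{finite,linorder})^('r::{finite,linorder})" and Pg2 :: "real^('r::{finite,linorder})^('s::{finite,linorder})"
    and x :: "real \<Rightarrow> 'w \<Rightarrow> real^('r + 's)" and xr :: "real \<Rightarrow> 'w \<Rightarrow> real^('r::{finite,linorder})"
    and y y_SPA :: "real \<Rightarrow> 'w \<Rightarrow> real^'p"
    and \<tau> :: real
  assumes "prob_space Pr"
    and "levy_process Pr M" and "square_integrable_process Pr M" and "mean_zero_process Pr M"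
    and "QM = second_moment_matrix Pr (M 1)"
    and "asymptotically_stable A"
    and "P = reachability_gramian A B QM" and "Q = observability_gramian A C"
    and "pos_def P" and "pos_def Q"
    and "hankel_singular_values P Q \<sigma>"
    and "\<sigma> (Inl (Max UNIV)) \<noteq> \<sigma> (Inr (Min UNIV))"
    and "balancing_factors P Q \<sigma> K L U V"
    and "T = balancing_transformation \<sigma> L U"
    and "At = T ** A ** matrix_inv T"
    and "A11 = left_cols (upper_rows At)" and "A12 = right_cols (upper_rows At)"
    and "A21 = left_cols (lower_rows At)" and "A22 = right_cols (lower_rows At)"
    and "B1 = upper_rows (T ** B)" and "B2 = lower_rows (T ** B)"
    and "C1 = left_cols (C ** matrix_inv T)" and "C2 = right_cols (C ** matrix_inv T)"
    and "Sigma2 = right_cols (lower_rows (diag_mat \<sigma>))"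
    and "Abar = A11 - A12 ** matrix_inv A22 ** A21"
    and "Cbar = C1 - C2 ** matrix_inv A22 ** A21"
    and "linear_sde_solution Pr A B M 0 x" and "y = (\<lambda>t w. C *v x t w)"
    and "linear_sde_solution Pr Abar B1 M 0 xr" and "y_SPA = (\<lambda>t w. Cbar *v xr t w)"
    and "A ** Pg + Pg ** transpose Abar = - (B ** QM ** transpose B1)"
    and "Pg1 = upper_rows (T ** Pg)" and "Pg2 = lower_rows (T ** Pg)"
    and "\<tau> > 0"
  shows "let bound = trace (Sigma2 ** (B2 ** QM ** transpose B2
             - 2 *\<^sub>R ((A22 ** Pg2 + A21 ** Pg1) ** transpose (matrix_inv A22 ** A21))))
         in 0 \<le> bound \<and>
            (SUP t\<in>{0..\<tau>}. \<integral>\<^sup>+ w. ennreal (norm (y t w - y_SPA t w)) \<partial>Pr) \<le> ennreal (sqrt bound)"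
proof -
  interpret prob_space Pr by fact
  have meas: "M 1 \<in> borel_measurable Pr" and sq: "integrable Pr (\<lambda>w. (norm (M 1 w))\<^sup>2)"
    using assms(2,3) by (auto simp: levy_process_def square_integrable_process_def)
  note mom = second_moment_matrix[OF meas sq]
  have QM: "transpose QM = QM" "\<And>v. 0 \<le> v \<bullet> (QM *v v)"
    unfolding assms(5) using mom(1) by (simp, simp add: mom(3)[symmetric])
  define bound where "bound = trace (Sigma2 ** (B2 ** QM ** transpose B2
             - 2 *\<^sub>R ((A22 ** Pg2 + A21 ** Pg1) ** transpose (matrix_inv A22 ** A21))))"
  note energy = spa_error_energy_le[OF QM assms(6,7,9,8,10-26,31-33), folded bound_def]
  have x_meas: "x t \<in> borel_measurable Pr" "xr t \<in> borel_measurable Pr" if "0 \<le> t" for t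
    using assms(27,29) that by (auto simp: linear_sde_solution_def)
  have le: "(\<integral>\<^sup>+ w. ennreal (norm (y t w - y_SPA t w)) \<partial>Pr) \<le> ennreal (sqrt bound)" if t: "0 \<le> t" for t
  proof (cases "t = 0")
    case True
    \<comment> \<open>At time 0 both solutions vanish, since the drift integral runs over a single point.\<close>
    have "(LBINT s:{0}. f s) = 0" for f :: "real \<Rightarrow> real^'q"
    proof -
      have "AE s in lborel. indicator {0} s *\<^sub>R f s = 0"
        using AE_lborel_singleton[of "0::real"] by eventually_elim (auto simp: indicator_def)
      then show ?thesis unfolding set_lebesgue_integral_def by (rule integral_eq_zero_AE)
    qed
    note zero = this
    have "AE w in Pr. \<forall>t\<ge>0. x t w = 0 + (LBINT s:{0..t}. A *v x s w) + B *v (M t w - M 0 w)"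
      "AE w in Pr. \<forall>t\<ge>0. xr t w = 0 + (LBINT s:{0..t}. Abar *v xr s w) + B1 *v (M t w - M 0 w)"
      using assms(27,29) by (simp_all add: linear_sde_solution_def)
    then have "AE w in Pr. x 0 w = 0 \<and> xr 0 w = 0"
      by eventually_elim (auto dest!: spec[of _ "0::real"] simp: zero)
    then have "AE w in Pr. ennreal (norm (y t w - y_SPA t w)) = 0"
      by eventually_elim (simp add: True assms(28,30))
    from nn_integral_cong_AE[OF this] show ?thesis by simp
  next
    case False
    then have "0 < t" using t by simp
    have "(\<integral>\<^sup>+ w. ennreal ((norm (C *v x t w - Cbar *v xr t w))\<^sup>2) \<partial>Pr) \<le> ennreal bound"
      using output_error_second_moment[OF assms(1-5,27,29) energy(3) \<open>0 < t\<close>] ennreal_leI[OF energy(2)[OF t]]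
      by (rule order_trans)
    then show ?thesis
      unfolding assms(28,30) using x_meas[OF t]
      by (intro nn_integral_norm_le_sqrt energy(1) borel_measurable_diff
          borel_measurable_matrix_vector_mult borel_measurable_const)
  qed
  show ?thesis
    unfolding Let_def bound_def[symmetric]
    using energy(1) le by (auto intro!: SUP_least)
qed

end
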